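(* Under the standing assumptions below, consider the nested subspace sampling model and the class $\mathcal{A}^{\rm ran}$. If the integration problem is strongly polynomially tractable, then $\mathrm{decay}_{\gamma,\sigma}>1$ for all $\sigma\in\mathbb{N}$. Moreover, if $\mathrm{decay}_{\gamma,\sigma}>1$ for all $\sigma\in\mathbb{N}$, then $$p^{\rm ran}_{\rm nest}\ge\max\Big\{\frac{2}{\alpha},\ \sup_{\sigma\in\mathbb{N}}\frac{2s/t^*_\sigma}{\mathrm{decay}_{\gamma,\sigma}-1}\Big\},$$ where a term with $\mathrm{decay}_{\gamma,\sigma}=\infty$ is interpreted as $0$.
   Context: Setting: $\mathcal{U}$ = finite subsets of $\mathbb{N}$; $D\subseteq\mathbb{R}$ Borel; $k$ a nonzero measurable reproducing kernel on $D\times D$ with anchor $a\in D$ ($k(a,a)=0$); $\rho$ a probability measure on $D$ with $M=\int k(x,x)\rho(dx)<\infty$; $k_u(\mathbf{x},\mathbf{y})=\prod_{j\in u}k(x_j,y_j)$, $k_\emptyset\equiv1$, RKHS $H_u$; weights $\gamma=(\gamma_u)_{u\in\mathcal{U}}\ge0$ with $\sum_u\gamma_uM^{|u|}<\infty$; $\mathcal{X}=\{\mathbf{x}\in D^{\mathbb{N}}:\sum_u\gamma_uk_u(\mathbf{x},\mathbf{x})<\infty\}$; $\mathcal{H}_\gamma$ the RKHS of $K_\gamma=\sum_u\gamma_uk_u$ on $\mathcal{X}$, unit ball $B_\gamma$; $I(f)=\int_{\mathcal{X}}f\,d\rho^{\mathbb{N}}$. Let $C_0=\int\int k\,d\rho\,d\rho>0$,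 $\widehat\gamma_u=\gamma_uC_0^{|u|}$. Algorithms access $f$ only through values $f(\mathbf{x})$, $\mathbf{x}\in D^{\mathbb{N}}$ ($f:=0$ off $\mathcal{X}$). Weights notions: for $\sigma\in\mathbb{N}\cup\{\infty\}$, the cut-off weights are $\gamma^{(\sigma)}_u=\gamma_u$ if $|u|\le\sigma$ and $0$ otherwise; let $u_1(\sigma),u_2(\sigma),\dots$ be the distinct nonempty $u$ with $\gamma^{(\sigma)}_u>0$, ordered so that $\widehat\gamma_{u_1(\sigma)}\ge\widehat\gamma_{u_2(\sigma)}\ge\cdots$. $\mathrm{decay}_{\gamma,\sigma}=\sup\{p\in\mathbb{R}:\lim_{j\to\infty}\widehat\gamma_{u_j(\sigma)}j^p=0\}$ (equal to $\infty$ if there are finitely many such sets); $\mathrm{decay}_\gamma=\mathrm{decay}_{\gamma,\infty}$. $t^*_\sigma=\inf\{t\ge0:\exists C_t>0\ \forall v\in\mathcal{U}:\ |\{i:u_i(\sigma)\subseteq v\}|\le C_t|v|^t\}$. Cost and algorithms: fix nondecreasing $\$:\mathbb{N}_0\to[1,\infty]$. For $v\in\mathcal{U}$, $\mathcal{X}_{v,a}=\{\mathbf{x}\in D^{\mathbb{N}}:x_j=a\ \forall j\notin v\}$. A randomized algorithm $Q:\Omega\times\mathcal{H}_\gamma\to\mathbb{R}$ (possibly adaptive, nonlinear) yields for each $f$ a square-integrable random variable $Q(f)$ computed from (random) function values; given a cost function $c$ on $D^{\mathbb{N}}$, $\mathrm{cost}_c(Q,f)$ is the sum of $c(\mathbf{x})$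 over all evaluation points $\mathbf{x}$, assumed to be a random variable; $\mathcal{A}^{\rm ran}$ is the class of all such algorithms. Nested model: for a strictly increasing sequence $\mathrm{v}=(v_i)_{i\in\mathbb{N}}$ of nonempty sets in $\mathcal{U}$, $c_{\mathrm{v},a}(\mathbf{x})=\inf\{\$(|v_i|):\mathbf{x}\in\mathcal{X}_{v_i,a}\}$ ($\inf\emptyset=\infty$), and $\mathrm{cost}_{\rm nest}(Q,F)=\inf_{\mathrm{v}}\sup_{f\in F}\mathbb{E}(\mathrm{cost}_{c_{\mathrm{v},a}}(Q,f))$. Error: $e(Q,F)=(\sup_{f\in F}\mathbb{E}[(I(f)-Q(f))^2])^{1/2}$. Complexity: $\mathrm{comp}^{\rm ran}_{\rm nest}(\varepsilon)=\inf\{\mathrm{cost}_{\rm nest}(Q,B_\gamma):Q\in\mathcal{A}^{\rm ran},e(Q,B_\gamma)\le\varepsilon\}$. The problem is strongly polynomially tractable if $\mathrm{comp}\le C\varepsilon^{-p}$ for all $\varepsilon>0$ for some $C,p\ge0$; $p^{\rm ran}_{\rm nest}$ is the infimum of such $p$ (the exponent of strong polynomial tractability). Standing assumptions: $\$(\nu)=\Omega(\nu^s)$ for some $s\in(0,\infty)$; $\gamma_{\{1\}}>0$; and there is $\alpha>0$ such that the $N$th minimal randomized error for univariate integration $\int_Dg\,d\rho$ over the unit ball of $H(\gamma_{\{1\}}k)$ (infimum of randomized worst-case errors of randomized algorithms with expected cost at most $N$, each evaluation costing $\$(1)$) is $\Omega(N^{-\alpha/2})$. *)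

theory Defs
  imports "HOL-Probability.Probability"
begin

text \<open>A deterministic adaptive algorithm over evaluation points of type 'p:
  (next point as a function of the values seen so far,
   stopping rule as a function of the values seen so far,
   output as a function of all values seen).\<close>
type_synonym 'p alg = "(real list \<Rightarrow> 'p) \<times> (real list \<Rightarrow> bool) \<times> (real list \<Rightarrow> real)"

primrec alg_vals :: "'p alg \<Rightarrow> ('p \<Rightarrow> real) \<Rightarrow> nat \<Rightarrow> real list" where
  "alg_vals A f 0 = []"
| "alg_vals A f (Suc n) = alg_vals A f n @ [f (fst A (alg_vals A f n))]"

definition alg_stops :: "'p alg \<Rightarrow> ('p \<Rightarrow> real) \<Rightarrow> bool" where
  "alg_stops A f \<longleftrightarrow> (\<exists>n. fst (snd A) (alg_vals A f n))"

definition alg_nevals :: "'p alg \<Rightarrow> ('p \<Rightarrow> real) \<Rightarrow> nat" where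
  "alg_nevals A f = (LEAST n. fst (snd A) (alg_vals A f n))"

definition alg_out :: "'p alg \<Rightarrow> ('p \<Rightarrow> real) \<Rightarrow> real" where
  "alg_out A f = (if alg_stops A f then snd (snd A) (alg_vals A f (alg_nevals A f)) else 0)"

definition alg_cost :: "('p \<Rightarrow> ennreal) \<Rightarrow> 'p alg \<Rightarrow> ('p \<Rightarrow> real) \<Rightarrow> ennreal" where
  "alg_cost c A f = (if alg_stops A f
     then (\<Sum>i<alg_nevals A f. c (fst A (alg_vals A f i))) else top)"

definition ran_alg :: "'w measure \<Rightarrow> ('w \<Rightarrow> 'p alg) \<Rightarrow> ('p \<Rightarrow> real) set \<Rightarrow> ('p \<Rightarrow> ennreal) set \<Rightarrow> bool" where
  "ran_alg \<Omega> Q F Cs \<longleftrightarrow> prob_space \<Omega> \<and>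
     (\<forall>f\<in>F. (\<lambda>\<omega>. alg_out (Q \<omega>) f) \<in> borel_measurable \<Omega> \<and>
             integrable \<Omega> (\<lambda>\<omega>. (alg_out (Q \<omega>) f)\<^sup>2) \<and>
             (\<forall>c\<in>Cs. (\<lambda>\<omega>. alg_cost c (Q \<omega>) f) \<in> borel_measurable \<Omega>))"

definition exp_cost :: "('p \<Rightarrow> ennreal) \<Rightarrow> 'w measure \<Rightarrow> ('w \<Rightarrow> 'p alg) \<Rightarrow> ('p \<Rightarrow> real) set \<Rightarrow> ennreal" where
  "exp_cost c \<Omega> Q F = (SUP f\<in>F. \<integral>\<^sup>+ \<omega>. alg_cost c (Q \<omega>) f \<partial>\<Omega>)"

definition err_sq :: "(('p \<Rightarrow> real) \<Rightarrow> real) \<Rightarrow> 'w measure \<Rightarrow> ('w \<Rightarrow> 'p alg) \<Rightarrow> ('p \<Rightarrow> real) set \<Rightarrow> ennreal" where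
  "err_sq I \<Omega> Q F = (SUP f\<in>F. \<integral>\<^sup>+ \<omega>. ennreal ((I f - alg_out (Q \<omega>) f)\<^sup>2) \<partial>\<Omega>)"

definition wc_error :: "(('p \<Rightarrow> real) \<Rightarrow> real) \<Rightarrow> 'w measure \<Rightarrow> ('w \<Rightarrow> 'p alg) \<Rightarrow> ('p \<Rightarrow> real) set \<Rightarrow> ennreal" where
  "wc_error I \<Omega> Q F = (if err_sq I \<Omega> Q F = top then top else ennreal (sqrt (enn2real (err_sq I \<Omega> Q F))))"

definition pd_kernel :: "'a set \<Rightarrow> ('a \<Rightarrow> 'a \<Rightarrow> real) \<Rightarrow> bool" where
  "pd_kernel S K \<longleftrightarrow> (\<forall>x\<in>S. \<forall>y\<in>S. K x y = K y x) \<and>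
     (\<forall>n (xs::nat \<Rightarrow> 'a) (c::nat \<Rightarrow> real). (\<forall>i<n. xs i \<in> S) \<longrightarrow>
        0 \<le> (\<Sum>i<n. \<Sum>j<n. c i * c j * K (xs i) (xs j)))"

text \<open>RKHS H(K) of a kernel K on S (functions extended by 0 outside S), via Aronszajn's
  characterisation: f \<in> H(K) with norm \<le> sqrt C iff C K(x,y) - f(x) f(y) is positive semidefinite.\<close>
definition rkhs :: "'a set \<Rightarrow> ('a \<Rightarrow> 'a \<Rightarrow> real) \<Rightarrow> ('a \<Rightarrow> real) set" where
  "rkhs S K = {f. (\<forall>x. x \<notin> S \<longrightarrow> f x = 0) \<and>
     (\<exists>C. \<forall>n (xs::nat \<Rightarrow> 'a) (c::nat \<Rightarrow> real). (\<forall>i<n. xs i \<in> S) \<longrightarrow>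
        (\<Sum>i<n. c i * f (xs i))\<^sup>2 \<le> C * (\<Sum>i<n. \<Sum>j<n. c i * c j * K (xs i) (xs j)))}"

definition rkhs_ball :: "'a set \<Rightarrow> ('a \<Rightarrow> 'a \<Rightarrow> real) \<Rightarrow> ('a \<Rightarrow> real) set" where
  "rkhs_ball S K = {f. (\<forall>x. x \<notin> S \<longrightarrow> f x = 0) \<and>
     (\<forall>n (xs::nat \<Rightarrow> 'a) (c::nat \<Rightarrow> real). (\<forall>i<n. xs i \<in> S) \<longrightarrow>
        (\<Sum>i<n. c i * f (xs i))\<^sup>2 \<le> (\<Sum>i<n. \<Sum>j<n. c i * c j * K (xs i) (xs j)))}"

definition kprod :: "(real \<Rightarrow> real \<Rightarrow> real) \<Rightarrow> nat set \<Rightarrow> (nat \<Rightarrow> real) \<Rightarrow> (nat \<Rightarrow> real) \<Rightarrow> real" where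
  "kprod k u x y = (\<Prod>j\<in>u. k (x j) (y j))"

definition Kgamma :: "(nat set \<Rightarrow> real) \<Rightarrow> (real \<Rightarrow> real \<Rightarrow> real) \<Rightarrow> (nat \<Rightarrow> real) \<Rightarrow> (nat \<Rightarrow> real) \<Rightarrow> real" where
  "Kgamma \<gamma> k x y = infsum (\<lambda>u. \<gamma> u * kprod k u x y) {u. finite u}"

definition Xdom :: "real set \<Rightarrow> (nat set \<Rightarrow> real) \<Rightarrow> (real \<Rightarrow> real \<Rightarrow> real) \<Rightarrow> (nat \<Rightarrow> real) set" where
  "Xdom D \<gamma> k = {x. (\<forall>j. x j \<in> D) \<and> (\<lambda>u. \<gamma> u * kprod k u x x) summable_on {u. finite u}}"

definition Hgamma where "Hgamma D \<gamma> k = rkhs (Xdom D \<gamma> k) (Kgamma \<gamma> k)"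
definition Bgamma where "Bgamma D \<gamma> k = rkhs_ball (Xdom D \<gamma> k) (Kgamma \<gamma> k)"

definition Iint :: "real measure \<Rightarrow> ((nat \<Rightarrow> real) \<Rightarrow> real) \<Rightarrow> real" where
  "Iint \<rho> f = integral\<^sup>L (PiM UNIV (\<lambda>_::nat. \<rho>)) f"

definition Xva :: "real set \<Rightarrow> real \<Rightarrow> nat set \<Rightarrow> (nat \<Rightarrow> real) set" where
  "Xva D a v = {x. (\<forall>j. x j \<in> D) \<and> (\<forall>j. j \<notin> v \<longrightarrow> x j = a)}"

definition nested_seq :: "(nat \<Rightarrow> nat set) \<Rightarrow> bool" where
  "nested_seq v \<longleftrightarrow> (\<forall>i. finite (v i) \<and> v i \<noteq> {} \<and> v i \<subset> v (Suc i))"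

definition c_nest :: "(nat \<Rightarrow> ennreal) \<Rightarrow> real set \<Rightarrow> real \<Rightarrow> (nat \<Rightarrow> nat set) \<Rightarrow> (nat \<Rightarrow> real) \<Rightarrow> ennreal" where
  "c_nest dollar D a v x = (INF i\<in>{i. x \<in> Xva D a (v i)}. dollar (card (v i)))"

definition cost_nest :: "(nat \<Rightarrow> ennreal) \<Rightarrow> real set \<Rightarrow> real \<Rightarrow> 'w measure \<Rightarrow> ('w \<Rightarrow> (nat \<Rightarrow> real) alg)
    \<Rightarrow> ((nat \<Rightarrow> real) \<Rightarrow> real) set \<Rightarrow> ennreal" where
  "cost_nest dollar D a \<Omega> Q F = (INF v\<in>{v. nested_seq v}. exp_cost (c_nest dollar D a v) \<Omega> Q F)"

definition comp_nest :: "'w itself \<Rightarrow> real set \<Rightarrow> (real \<Rightarrow> real \<Rightarrow> real) \<Rightarrow> real \<Rightarrow> real measure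
    \<Rightarrow> (nat set \<Rightarrow> real) \<Rightarrow> (nat \<Rightarrow> ennreal) \<Rightarrow> real \<Rightarrow> ennreal" where
  "comp_nest W D k a \<rho> \<gamma> dollar \<epsilon> =
     (INF p\<in>{(\<Omega>::'w measure, Q). ran_alg \<Omega> Q (Hgamma D \<gamma> k) {c_nest dollar D a v | v. nested_seq v} \<and>
              wc_error (Iint \<rho>) \<Omega> Q (Bgamma D \<gamma> k) \<le> ennreal \<epsilon>}.
        cost_nest dollar D a (fst p) (snd p) (Bgamma D \<gamma> k))"

definition strong_poly_tractable :: "'w itself \<Rightarrow> real set \<Rightarrow> (real \<Rightarrow> real \<Rightarrow> real) \<Rightarrow> real \<Rightarrow> real measure
    \<Rightarrow> (nat set \<Rightarrow> real) \<Rightarrow> (nat \<Rightarrow> ennreal) \<Rightarrow> bool" where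
  "strong_poly_tractable W D k a \<rho> \<gamma> dollar \<longleftrightarrow>
     (\<exists>C p. C \<ge> 0 \<and> p \<ge> 0 \<and> (\<forall>\<epsilon>>0. comp_nest W D k a \<rho> \<gamma> dollar \<epsilon> \<le> ennreal (C * \<epsilon> powr (-p))))"

text \<open>Exponent of strong polynomial tractability (= \<infinity> if not strongly polynomially tractable).\<close>
definition p_ran_nest :: "'w itself \<Rightarrow> real set \<Rightarrow> (real \<Rightarrow> real \<Rightarrow> real) \<Rightarrow> real \<Rightarrow> real measure
    \<Rightarrow> (nat set \<Rightarrow> real) \<Rightarrow> (nat \<Rightarrow> ennreal) \<Rightarrow> ereal" where
  "p_ran_nest W D k a \<rho> \<gamma> dollar = Inf {ereal p | p. p \<ge> 0 \<and>
     (\<exists>C\<ge>0. \<forall>\<epsilon>>0. comp_nest W D k a \<rho> \<gamma> dollar \<epsilon> \<le> ennreal (C * \<epsilon> powr (-p)))}"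

text \<open>N-th minimal randomized error for \<integral>_D g d\<rho> over the unit ball of H(\<gamma>_{1} k),
  each evaluation costing $(1). (Coordinate 1 of the paper is coordinate 0 here.)\<close>
definition min_err_uni :: "'w itself \<Rightarrow> real set \<Rightarrow> (real \<Rightarrow> real \<Rightarrow> real) \<Rightarrow> real measure
    \<Rightarrow> (nat set \<Rightarrow> real) \<Rightarrow> (nat \<Rightarrow> ennreal) \<Rightarrow> nat \<Rightarrow> ennreal" where
  "min_err_uni W D k \<rho> \<gamma> dollar N =
     (INF p\<in>{(\<Omega>::'w measure, Q). ran_alg \<Omega> Q (rkhs D (\<lambda>x y. \<gamma> {0} * k x y)) {\<lambda>_. dollar 1} \<and>
              exp_cost (\<lambda>_. dollar 1) \<Omega> Q (rkhs_ball D (\<lambda>x y. \<gamma> {0} * k x y)) \<le> of_nat N}.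
        wc_error (\<lambda>g. \<integral>x. g x \<partial>\<rho>) (fst p) (snd p) (rkhs_ball D (\<lambda>x y. \<gamma> {0} * k x y)))"

definition C0 :: "real measure \<Rightarrow> (real \<Rightarrow> real \<Rightarrow> real) \<Rightarrow> real" where
  "C0 \<rho> k = (\<integral>x. \<integral>y. k x y \<partial>\<rho> \<partial>\<rho>)"

definition gamma_hat :: "real measure \<Rightarrow> (real \<Rightarrow> real \<Rightarrow> real) \<Rightarrow> (nat set \<Rightarrow> real) \<Rightarrow> nat set \<Rightarrow> real" where
  "gamma_hat \<rho> k \<gamma> u = \<gamma> u * C0 \<rho> k ^ card u"

text \<open>Nonempty sets with positive cut-off weight \<gamma>^(\<sigma>).\<close>
definition wsets :: "(nat set \<Rightarrow> real) \<Rightarrow> nat \<Rightarrow> nat set set" where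
  "wsets \<gamma> \<sigma> = {u. finite u \<and> u \<noteq> {} \<and> card u \<le> \<sigma> \<and> \<gamma> u > 0}"

text \<open>Enumeration u_1(\<sigma>), u_2(\<sigma>), ... (index j here is u_{j+1} of the paper),
  with non-increasing \<gamma>-hat.\<close>
definition wenum :: "real measure \<Rightarrow> (real \<Rightarrow> real \<Rightarrow> real) \<Rightarrow> (nat set \<Rightarrow> real) \<Rightarrow> nat \<Rightarrow> nat \<Rightarrow> nat set" where
  "wenum \<rho> k \<gamma> \<sigma> = (SOME e. bij_betw e UNIV (wsets \<gamma> \<sigma>) \<and>
      (\<forall>i j. i \<le> j \<longrightarrow> gamma_hat \<rho> k \<gamma> (e j) \<le> gamma_hat \<rho> k \<gamma> (e i)))"

definition decay :: "real measure \<Rightarrow> (real \<Rightarrow> real \<Rightarrow> real) \<Rightarrow> (nat set \<Rightarrow> real) \<Rightarrow> nat \<Rightarrow> ereal" where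
  "decay \<rho> k \<gamma> \<sigma> = (if finite (wsets \<gamma> \<sigma>) then \<infinity>
     else Sup {ereal p | p. (\<lambda>j. gamma_hat \<rho> k \<gamma> (wenum \<rho> k \<gamma> \<sigma> j) * real (Suc j) powr p) \<longlonglongrightarrow> 0})"

definition t_star :: "(nat set \<Rightarrow> real) \<Rightarrow> nat \<Rightarrow> ereal" where
  "t_star \<gamma> \<sigma> = Inf {ereal t | t. t \<ge> 0 \<and> (\<exists>C>0. \<forall>v. finite v \<longrightarrow>
      real (card {u \<in> wsets \<gamma> \<sigma>. u \<subseteq> v}) \<le> C * real (card v) powr t)}"

definition lb_term :: "real measure \<Rightarrow> (real \<Rightarrow> real \<Rightarrow> real) \<Rightarrow> (nat set \<Rightarrow> real) \<Rightarrow> real \<Rightarrow> nat \<Rightarrow> ereal" where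
  "lb_term \<rho> k \<gamma> s \<sigma> = (if decay \<rho> k \<gamma> \<sigma> = \<infinity> then 0
     else ereal (2 * s) / t_star \<gamma> \<sigma> / (decay \<rho> k \<gamma> \<sigma> - 1))"

end

theory Submission
  imports Defs
begin

text \<open>The terms involving \<open>t_star\<close> and the decay come from fooling functions. Let \<open>m x = \<integral>k(x,y) \<rho>(dy)\<close>
  be the mean embedding of \<open>\<rho>\<close>. For a finite family \<open>F\<close> of coordinate sets, the normalised sum of
  \<open>\<gamma> u * (\<Prod>j\<in>u. m (x j))\<close> over \<open>u \<in> F\<close> lies in the unit ball, its squared integral is the sum of
  the \<open>gamma_hat u\<close>, and, as \<open>m a = 0\<close>, it vanishes at all points anchored outside \<open>V\<close> if no
  \<open>u \<in> F\<close> is contained in \<open>V\<close>. By Markov's inequality, an algorithm of cost below \<open>N\<close> that is run on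
  the zero function uses, with probability at least \<open>1/2\<close>, only points anchored outside a set \<open>V\<close> of
  size \<open>O(N powr (1/s))\<close>; then it cannot tell the fooling function from its negative. Hence the sets
  not contained in \<open>V\<close> have total weight at most \<open>2 \<epsilon>\<^sup>2\<close>. As \<open>V\<close> contains at most \<open>O((card V) powr t)\<close>
  of the sets, this bounds the decay of the ordered weights from below.

  The term \<open>2/\<alpha>\<close> holds because an algorithm for the infinite-dimensional problem also integrates
  functions of the first coordinate, at no larger cost.\<close>

section \<open>Positive semidefinite kernels\<close>

definition quad_form :: "('a \<Rightarrow> 'a \<Rightarrow> real) \<Rightarrow> nat \<Rightarrow> (nat \<Rightarrow> real) \<Rightarrow> (nat \<Rightarrow> 'a) \<Rightarrow> real" where
  "quad_form K n c xs = (\<Sum>i<n. \<Sum>j<n. c i * c j * K (xs i) (xs j))"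

lemma pd_kernelD_sym: "pd_kernel S K \<Longrightarrow> x \<in> S \<Longrightarrow> y \<in> S \<Longrightarrow> K x y = K y x"
  by (auto simp: pd_kernel_def)

lemma pd_kernelD: "pd_kernel S K \<Longrightarrow> (\<And>i. i < n \<Longrightarrow> xs i \<in> S) \<Longrightarrow> 0 \<le> quad_form K n c xs"
  by (auto simp: pd_kernel_def quad_form_def)

lemma pd_kernelI:
  assumes "\<And>x y. x \<in> S \<Longrightarrow> y \<in> S \<Longrightarrow> K x y = K y x"
    and "\<And>n xs c. (\<And>i. i < n \<Longrightarrow> xs i \<in> S) \<Longrightarrow> 0 \<le> quad_form K n c xs"
  shows "pd_kernel S K"
  using assms by (auto simp: pd_kernel_def quad_form_def)

lemma quad_form_add: "quad_form (\<lambda>x y. K x y + L x y) n c xs = quad_form K n c xs + quad_form L n c xs"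
  by (simp add: quad_form_def algebra_simps sum.distrib)

lemma quad_form_diff: "quad_form (\<lambda>x y. K x y - L x y) n c xs = quad_form K n c xs - quad_form L n c xs"
  by (simp add: quad_form_def algebra_simps sum_subtractf)

lemma quad_form_scale: "quad_form (\<lambda>x y. b * K x y) n c xs = b * quad_form K n c xs"
  by (simp add: quad_form_def algebra_simps sum_distrib_left)

lemma quad_form_rank_one: "quad_form (\<lambda>x y. g x * g y) n c xs = (\<Sum>i<n. c i * g (xs i))\<^sup>2"
  by (simp add: quad_form_def power2_eq_square sum_product algebra_simps)

text \<open>A point appended with a free weight \<open>t\<close> turns the form into a quadratic
  polynomial in \<open>t\<close>. Cauchy-Schwarz and the averaging over random points both start
  from this expansion.\<close>

lemma quad_form_insert:
  assumes "\<And>i. i < n \<Longrightarrow> K z (xs i) = K (xs i) z"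
  shows "quad_form K (Suc n) (c(n := t)) (xs(n := z)) =
    quad_form K n c xs + 2 * t * (\<Sum>i<n. c i * K (xs i) z) + t\<^sup>2 * K z z"
proof -
  have "(\<Sum>j<n. t * (c j * K z (xs j))) = t * (\<Sum>i<n. c i * K (xs i) z)"
    unfolding sum_distrib_left using assms by (intro sum.cong) auto
  moreover have "(\<Sum>j<n. c j * (t * K (xs j) z)) = t * (\<Sum>i<n. c i * K (xs i) z)"
    unfolding sum_distrib_left by (intro sum.cong) auto
  ultimately show ?thesis
    by (simp add: quad_form_def sum.distrib power2_eq_square mult.assoc)
qed

text \<open>The discriminant condition. For \<open>d > 0\<close> the polynomial is tested at its
  minimiser \<open>- L / d\<close>; for \<open>d = 0\<close> it is affine in \<open>t\<close> and
  can stay nonnegative only if \<open>L = 0\<close>.\<close>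

lemma square_le_of_quadratic_nonneg:
  fixes Q L d :: real
  assumes "\<And>t. 0 \<le> Q + 2 * t * L + t\<^sup>2 * d" and "0 \<le> d"
  shows "L\<^sup>2 \<le> Q * d"
proof (cases "d = 0")
  case True
  have "L = 0"
  proof (rule ccontr)
    assume "L \<noteq> 0"
    \<comment> \<open>This \<open>t\<close> makes \<open>Q + 2 * t * L\<close> equal to
      \<open>-1\<close>.\<close>
    then show False using assms(1)[of "- (Q + 1) / (2 * L)"] True by (simp add: field_simps)
  qed
  then show ?thesis using True by simp
next
  case False
  then have "0 \<le> (Q + 2 * (- L / d) * L + (- L / d)\<^sup>2 * d) * d"
    by (intro mult_nonneg_nonneg assms)
  also have "\<dots> = Q * d - L\<^sup>2"
    using False by (simp add: field_simps power2_eq_square)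
  finally show ?thesis by simp
qed

lemma pd_kernel_diag_nonneg: "pd_kernel S K \<Longrightarrow> z \<in> S \<Longrightarrow> 0 \<le> K z z"
  using pd_kernelD[of S K 1 "\<lambda>_. z" "\<lambda>_. 1"] by (simp add: quad_form_def)

lemma pd_kernel_insert_nonneg:
  assumes K: "pd_kernel S K" and xs: "\<And>i. i < n \<Longrightarrow> xs i \<in> S" and z: "z \<in> S"
  shows "0 \<le> quad_form K n c xs + 2 * t * (\<Sum>i<n. c i * K (xs i) z) + t\<^sup>2 * K z z"
proof -
  have "0 \<le> quad_form K (Suc n) (c(n := t)) (xs(n := z))"
    using xs z by (intro pd_kernelD[OF K]) (auto simp: less_Suc_eq)
  then show ?thesis
    using quad_form_insert[of n K z xs c t] pd_kernelD_sym[OF K] xs z by simp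
qed

lemma pd_kernel_Cauchy_Schwarz_sum:
  assumes "pd_kernel S K" "\<And>i. i < n \<Longrightarrow> xs i \<in> S" "z \<in> S"
  shows "(\<Sum>i<n. c i * K (xs i) z)\<^sup>2 \<le> quad_form K n c xs * K z z"
  using assms by (intro square_le_of_quadratic_nonneg pd_kernel_insert_nonneg pd_kernel_diag_nonneg)

lemma pd_kernel_Cauchy_Schwarz:
  assumes "pd_kernel S K" "x \<in> S" "z \<in> S"
  shows "(K x z)\<^sup>2 \<le> K x x * K z z"
  using pd_kernel_Cauchy_Schwarz_sum[of S K 1 "\<lambda>_. x" z "\<lambda>_. 1"] assms by (simp add: quad_form_def)

text \<open>A weak form of Cauchy-Schwarz. The bound by a sum of diagonal values lets integrability
  and summability on the diagonal carry over to all pairs of points.\<close>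

lemma pd_kernel_abs_le:
  assumes "pd_kernel S K" "x \<in> S" "z \<in> S"
  shows "\<bar>K x z\<bar> \<le> K x x + K z z"
proof (rule power2_le_imp_le)
  have nonneg: "0 \<le> K x x" "0 \<le> K z z" using assms by (auto intro: pd_kernel_diag_nonneg)
  have "(K x z)\<^sup>2 \<le> K x x * K z z" by (rule pd_kernel_Cauchy_Schwarz[OF assms])
  also have "\<dots> \<le> (K x x + K z z)\<^sup>2"
    unfolding power2_eq_square using nonneg by (intro mult_mono) auto
  finally show "\<bar>K x z\<bar>\<^sup>2 \<le> (K x x + K z z)\<^sup>2" by simp
  show "0 \<le> K x x + K z z" using nonneg by simp
qed

text \<open>The form of the complement is that of \<open>K\<close> minus the squared sum against
  \<open>z\<close> divided by \<open>K z z\<close>, so its nonnegativity is the Cauchy-Schwarz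
  inequality for the point \<open>z\<close>.\<close>

lemma pd_kernel_Schur_complement:
  assumes K: "pd_kernel S K" and z: "z \<in> S"
  shows "pd_kernel S (\<lambda>x y. K x y - K x z * K y z / K z z)"
proof (rule pd_kernelI)
  fix n and xs :: "nat \<Rightarrow> 'a" and c :: "nat \<Rightarrow> real"
  assume xs: "\<And>i. i < n \<Longrightarrow> xs i \<in> S"
  have *: "quad_form (\<lambda>x y. K x y - K x z * K y z / K z z) n c xs =
      quad_form K n c xs - (\<Sum>i<n. c i * K (xs i) z)\<^sup>2 / K z z"
    using quad_form_diff[of K "\<lambda>x y. 1 / K z z * (K x z * K y z)" n c xs]
    by (simp add: quad_form_scale[of "1 / K z z"] quad_form_rank_one del: times_divide_eq_left)
       (simp add: quad_form_scale[of "1 / K z z"] quad_form_rank_one)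
  show "0 \<le> quad_form (\<lambda>x y. K x y - K x z * K y z / K z z) n c xs"
  proof (cases "K z z = 0")
    case True then show ?thesis using * pd_kernelD[OF K xs] by simp
  next
    case False
    then have "0 < K z z" using pd_kernel_diag_nonneg[OF K z] by simp
    then show ?thesis
      using * pd_kernel_Cauchy_Schwarz_sum[where c = c, OF K xs z] by (simp add: divide_le_eq)
  qed
qed (use pd_kernelD_sym[OF K] in auto)

text \<open>The Schur product theorem, by Cholesky elimination of one point at a time.
  If \<open>K z z = 0\<close>, the Schur complement is \<open>K\<close> itself, and \<open>K x z = 0\<close> by Cauchy-Schwarz.\<close>
lemma pd_kernel_mult:
  assumes K: "pd_kernel S K" and L: "pd_kernel S L"
  shows "pd_kernel S (\<lambda>x y. K x y * L x y)"
proof (rule pd_kernelI)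
  fix n and xs :: "nat \<Rightarrow> 'a" and c :: "nat \<Rightarrow> real"
  assume "\<And>i. i < n \<Longrightarrow> xs i \<in> S"
  with K show "0 \<le> quad_form (\<lambda>x y. K x y * L x y) n c xs"
  proof (induction n arbitrary: K)
    case 0 then show ?case by (simp add: quad_form_def)
  next
    case (Suc n)
    define z where "z = xs n"
    define K' where "K' = (\<lambda>x y. K x y - K x z * K y z / K z z)"
    have z: "z \<in> S" using Suc.prems by (simp add: z_def)
    have K': "pd_kernel S K'" unfolding K'_def by (rule pd_kernel_Schur_complement[OF Suc.prems(1) z])
    have K'z: "K' x z = 0" if "x \<in> S" for x
    proof (cases "K z z = 0")
      case True
      then show ?thesis using pd_kernel_Cauchy_Schwarz[OF Suc.prems(1) that z] by (simp add: K'_def)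
    qed (simp add: K'_def)
    have "0 \<le> quad_form (\<lambda>x y. K' x y * L x y) n c xs"
      using Suc K' by auto
    \<comment> \<open>The row and the column of \<open>z\<close> vanish in \<open>K'\<close>, so the
      last point contributes nothing and the induction hypothesis for \<open>n\<close> points
      suffices.\<close>
    also have "\<dots> = quad_form (\<lambda>x y. K' x y * L x y) (Suc n) c xs"
      using K'z Suc.prems(2) pd_kernelD_sym[OF K' z]
      by (simp add: quad_form_def flip: z_def)
    finally have 1: "0 \<le> quad_form (\<lambda>x y. K' x y * L x y) (Suc n) c xs" .
    \<comment> \<open>The remaining part of \<open>K\<close> has rank one; its factors are absorbed
      into the weights, which leaves a form of \<open>L\<close>.\<close>
    have "0 \<le> 1 / K z z * quad_form L (Suc n) (\<lambda>i. c i * K (xs i) z) xs"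
      using pd_kernelD[OF L Suc.prems(2)] pd_kernel_diag_nonneg[OF Suc.prems(1) z]
      by (intro mult_nonneg_nonneg) auto
    also have "\<dots> = quad_form (\<lambda>x y. K x z * K y z / K z z * L x y) (Suc n) c xs"
      unfolding quad_form_def sum_distrib_left by (intro sum.cong) auto
    finally have "0 \<le> \<dots>" .
    with 1 have "0 \<le> quad_form (\<lambda>x y. K' x y * L x y + K x z * K y z / K z z * L x y) (Suc n) c xs"
      unfolding quad_form_add by simp
    then show ?case by (simp add: K'_def algebra_simps)
  qed
qed (use pd_kernelD_sym[OF K] pd_kernelD_sym[OF L] in auto)

section \<open>Closure properties and coordinatewise product kernels\<close>

lemma pd_kernel_pullback:
  assumes "pd_kernel S K" "\<And>x. x \<in> T \<Longrightarrow> h x \<in> S"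
  shows "pd_kernel T (\<lambda>x y. K (h x) (h y))"
proof (rule pd_kernelI)
  fix n and xs :: "nat \<Rightarrow> 'b" and c :: "nat \<Rightarrow> real"
  assume "\<And>i. i < n \<Longrightarrow> xs i \<in> T"
  then have "0 \<le> quad_form K n c (\<lambda>i. h (xs i))" using assms by (intro pd_kernelD) auto
  then show "0 \<le> quad_form (\<lambda>x y. K (h x) (h y)) n c xs" by (simp add: quad_form_def)
qed (simp add: pd_kernelD_sym[OF assms(1)] assms(2))

lemma pd_kernel_add:
  assumes "pd_kernel S K" "pd_kernel S L"
  shows "pd_kernel S (\<lambda>x y. K x y + L x y)"
proof (rule pd_kernelI)
  fix x y assume "x \<in> S" "y \<in> S"
  then show "K x y + L x y = K y x + L y x"
    using pd_kernelD_sym[OF assms(1)] pd_kernelD_sym[OF assms(2)] by metis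
qed (simp add: quad_form_add pd_kernelD[OF assms(1)] pd_kernelD[OF assms(2)])

lemma pd_kernel_scale:
  assumes "0 \<le> b" "pd_kernel S K"
  shows "pd_kernel S (\<lambda>x y. b * K x y)"
proof (rule pd_kernelI)
  fix x y assume "x \<in> S" "y \<in> S"
  then show "b * K x y = b * K y x" using pd_kernelD_sym[OF assms(2)] by metis
qed (simp add: quad_form_scale pd_kernelD[OF assms(2)] assms(1))

lemma pd_kernel_rank_one: "pd_kernel S (\<lambda>x y. g x * g y)"
  by (intro pd_kernelI) (auto simp: quad_form_rank_one)

lemma pd_kernel_one: "pd_kernel S (\<lambda>x y. 1)"
  using pd_kernel_rank_one[of S "\<lambda>_. 1"] by simp

lemma pd_kernel_kprod:
  assumes "pd_kernel D k" "finite u"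
  shows "pd_kernel {x. \<forall>j. x j \<in> D} (kprod k u)"
  using assms(2)
proof induction
  case empty then show ?case using pd_kernel_one by (simp add: kprod_def[abs_def])
next
  case (insert j u)
  have "pd_kernel {x. \<forall>j. x j \<in> D} (\<lambda>x y. k (x j) (y j) * kprod k u x y)"
    by (intro pd_kernel_mult pd_kernel_pullback[OF assms(1)] insert.IH) auto
  then show ?case using insert by (simp add: kprod_def[abs_def])
qed

text \<open>The difference of products is telescoped into products of positive semidefinite kernels.\<close>
lemma pd_kernel_kprod_minus_rank_one:
  assumes k: "pd_kernel D k" and b: "0 \<le> b" and diff: "pd_kernel D (\<lambda>x y. b * k x y - m x * m y)"
    and u: "finite u"
  shows "pd_kernel {x. \<forall>j. x j \<in> D}
    (\<lambda>x y. b ^ card u * kprod k u x y - (\<Prod>j\<in>u. m (x j)) * (\<Prod>j\<in>u. m (y j)))"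
  using u
proof induction
  case empty
  have "pd_kernel {x. \<forall>j. x j \<in> D} (\<lambda>x y. 0)" using pd_kernel_rank_one[of _ "\<lambda>_. 0"] by simp
  then show ?case by (simp add: kprod_def[abs_def])
next
  case (insert j u)
  let ?S = "{x. \<forall>j. x j \<in> D}" and ?m = "\<lambda>x. \<Prod>j\<in>u. m (x j)"
  have "pd_kernel ?S (\<lambda>x y. (b * k (x j) (y j) - m (x j) * m (y j)) * (b ^ card u * kprod k u x y))"
    using b insert.hyps
    by (intro pd_kernel_mult pd_kernel_pullback[OF diff] pd_kernel_scale pd_kernel_kprod[OF k]) auto
  moreover have "pd_kernel ?S (\<lambda>x y. m (x j) * m (y j) * (b ^ card u * kprod k u x y - ?m x * ?m y))"
    by (intro pd_kernel_mult pd_kernel_rank_one insert.IH)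
  ultimately have "pd_kernel ?S (\<lambda>x y.
      (b * k (x j) (y j) - m (x j) * m (y j)) * (b ^ card u * kprod k u x y) +
      m (x j) * m (y j) * (b ^ card u * kprod k u x y - ?m x * ?m y))"
    by (rule pd_kernel_add)
  then show ?case using insert by (simp add: kprod_def[abs_def] algebra_simps)
qed

section \<open>The mean embedding\<close>

locale kernel_prob_space = prob_space \<rho> for \<rho> :: "real measure" +
  fixes D :: "real set" and k :: "real \<Rightarrow> real \<Rightarrow> real"
  assumes k_kernel: "pd_kernel D k"
    and k_meas: "case_prod k \<in> borel_measurable (restrict_space borel D \<Otimes>\<^sub>M restrict_space borel D)"
    and rho_sets: "sets \<rho> = sets (restrict_space borel D)"
    and M_finite: "integrable \<rho> (\<lambda>x. k x x)"
begin

abbreviation M where "M \<equiv> \<integral>x. k x x \<partial>\<rho>"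

definition mean :: "real \<Rightarrow> real" where "mean x = (\<integral>y. k x y \<partial>\<rho>)"

lemma space_rho: "space \<rho> = D"
  using sets_eq_imp_space_eq[OF rho_sets] by (simp add: space_restrict_space)

lemma k_measurable_pair: "case_prod k \<in> borel_measurable (\<rho> \<Otimes>\<^sub>M \<rho>)"
proof -
  have "sets (\<rho> \<Otimes>\<^sub>M \<rho>) = sets (restrict_space borel D \<Otimes>\<^sub>M restrict_space borel D)"
    by (rule sets_pair_measure_cong[OF rho_sets rho_sets])
  from measurable_cong_sets[OF this refl] show ?thesis using k_meas by blast
qed

text \<open>Stated for composed arguments, so that diagonals \<open>k x x\<close> and sections
  \<open>k x\<close> are covered by one measurability rule.\<close>

lemma k_measurable [measurable (raw)]:
  assumes [measurable]: "f \<in> N \<rightarrow>\<^sub>M \<rho>" "g \<in> N \<rightarrow>\<^sub>M \<rho>"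
  shows "(\<lambda>x. k (f x) (g x)) \<in> borel_measurable N"
proof -
  have "(\<lambda>x. (f x, g x)) \<in> N \<rightarrow>\<^sub>M \<rho> \<Otimes>\<^sub>M \<rho>" by measurable
  from measurable_compose[OF this k_measurable_pair] show ?thesis by simp
qed

lemma integrable_section: "x \<in> D \<Longrightarrow> integrable \<rho> (k x)"
proof (rule Bochner_Integration.integrable_bound[of \<rho> "\<lambda>y. k x x + k y y"])
  assume x: "x \<in> D"
  then have "x \<in> space \<rho>" by (simp add: space_rho)
  then show "k x \<in> borel_measurable \<rho>" by measurable
  show "AE y in \<rho>. norm (k x y) \<le> norm (k x x + k y y)"
    using pd_kernel_abs_le[OF k_kernel x] by (intro AE_I2) (force simp: space_rho)
qed (use M_finite in simp)

lemma mean_measurable [measurable]: "mean \<in> borel_measurable \<rho>"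
  unfolding mean_def[abs_def] by measurable

lemma abs_mean_le:
  assumes x: "x \<in> D" shows "\<bar>mean x\<bar> \<le> k x x + M"
proof -
  have "\<bar>mean x\<bar> \<le> (\<integral>y. \<bar>k x y\<bar> \<partial>\<rho>)" unfolding mean_def by (rule integral_abs_bound)
  also have "\<dots> \<le> (\<integral>y. k x x + k y y \<partial>\<rho>)"
    using integrable_section[OF x] M_finite pd_kernel_abs_le[OF k_kernel x]
    by (intro integral_mono) (auto simp: space_rho)
  also have "\<dots> = k x x + M" using M_finite by (simp add: prob_space)
  finally show ?thesis .
qed

lemma integrable_mean: "integrable \<rho> mean"
proof (rule Bochner_Integration.integrable_bound[of \<rho> "\<lambda>x. k x x + M"])
  show "AE x in \<rho>. norm (mean x) \<le> norm (k x x + M)"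
    using abs_mean_le by (intro AE_I2) (force simp: space_rho)
qed (use M_finite in simp_all)

lemma integral_mean: "(\<integral>x. mean x \<partial>\<rho>) = C0 \<rho> k"
  by (simp add: mean_def C0_def)

section \<open>Averaging over random points, and the norm of the mean embedding\<close>

text \<open>The expectation of the quadratic form after adding \<open>r\<close> independent random points, each with
  weight \<open>t\<close>.\<close>
lemma quad_form_random_points_nonneg:
  assumes "\<And>i. i < n \<Longrightarrow> xs i \<in> D"
  shows "0 \<le> quad_form k n c xs + 2 * t * real r * (\<Sum>i<n. c i * mean (xs i))
    + t\<^sup>2 * (real r * (real r - 1) * C0 \<rho> k + real r * M)"
  using assms
proof (induction r arbitrary: n c xs)
  case 0 then show ?case using pd_kernelD[OF k_kernel] by simp
next
  case (Suc r)
  let ?Q = "quad_form k n c xs" and ?g = "\<Sum>i<n. c i * mean (xs i)"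
  let ?B = "t\<^sup>2 * (real r * (real r - 1) * C0 \<rho> k + real r * M)"
  let ?F = "\<lambda>y. ?Q + 2 * t * (\<Sum>i<n. c i * k (xs i) y) + t\<^sup>2 * k y y
      + 2 * t * real r * (?g + t * mean y) + ?B"
  \<comment> \<open>One of the \<open>Suc r\<close> random points is frozen at \<open>y\<close> and
    joined to the given points; the induction hypothesis treats the other \<open>r\<close>, and the
    integral over \<open>y\<close> then releases it.\<close>
  have "0 \<le> ?F y" if y: "y \<in> D" for y
  proof -
    have "(\<Sum>i<Suc n. (c(n := t)) i * mean ((xs(n := y)) i)) = ?g + t * mean y"
      by simp
    moreover have "quad_form k (Suc n) (c(n := t)) (xs(n := y)) =
        ?Q + 2 * t * (\<Sum>i<n. c i * k (xs i) y) + t\<^sup>2 * k y y"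
      using Suc.prems y pd_kernelD_sym[OF k_kernel] by (intro quad_form_insert) auto
    moreover have "\<And>i. i < Suc n \<Longrightarrow> (xs(n := y)) i \<in> D" using Suc.prems y by (auto simp: less_Suc_eq)
    ultimately show ?thesis using Suc.IH[of "Suc n" "xs(n := y)" "c(n := t)"]
      by (simp del: fun_upd_apply)
  qed
  then have "0 \<le> (\<integral>y. ?F y \<partial>\<rho>)"
    by (intro Bochner_Integration.integral_nonneg) (simp add: space_rho)
  also have "(\<integral>y. ?F y \<partial>\<rho>) = ?Q + 2 * t * ?g + t\<^sup>2 * M + 2 * t * real r * (?g + t * C0 \<rho> k) + ?B"
  proof -
    have "(\<integral>y. (\<Sum>i<n. c i * k (xs i) y) \<partial>\<rho>) = ?g"
      using integrable_section Suc.prems by (simp add: mean_def)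
    moreover have "integrable \<rho> (\<lambda>y. \<Sum>i<n. c i * k (xs i) y)"
      using integrable_section Suc.prems by auto
    ultimately show ?thesis
      using M_finite integrable_mean by (simp add: prob_space integral_mean)
  qed
  finally show ?case by (simp add: algebra_simps power2_eq_square)
qed

text \<open>An empirical measure of \<open>Suc r\<close> random points of weight
  \<open>t / real (Suc r)\<close> stands in for \<open>t\<close> times \<open>\<rho>\<close>. Its
  diagonal contributes a multiple of \<open>M / real (Suc r)\<close>, which disappears as
  \<open>r\<close> grows, while the off-diagonal pairs tend to \<open>C0\<close>.\<close>

lemma quad_form_mean_nonneg:
  assumes xs: "\<And>i. i < n \<Longrightarrow> xs i \<in> D"
  shows "0 \<le> quad_form k n c xs + 2 * t * (\<Sum>i<n. c i * mean (xs i)) + t\<^sup>2 * C0 \<rho> k"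
proof -
  let ?Q = "quad_form k n c xs" and ?g = "\<Sum>i<n. c i * mean (xs i)"
  let ?s = "\<lambda>r. ?Q + 2 * t * ?g + t\<^sup>2 * (real r * inverse (real (Suc r)) * C0 \<rho> k + inverse (real (Suc r)) * M)"
  have "0 \<le> ?s r" for r
  proof -
    have "0 \<le> ?Q + 2 * (t / real (Suc r)) * real (Suc r) * ?g + (t / real (Suc r))\<^sup>2 *
       (real (Suc r) * (real (Suc r) - 1) * C0 \<rho> k + real (Suc r) * M)"
      by (rule quad_form_random_points_nonneg[OF xs])
    also have "\<dots> = ?s r"
    proof -
      have "(t / b)\<^sup>2 * (b * (b - 1) * x + b * y) = t\<^sup>2 * ((b - 1) * inverse b * x + inverse b * y)"
        if "b \<noteq> 0" for b x y :: real
        using that by (simp add: field_simps power2_eq_square)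
      from this[of "real (Suc r)"] show ?thesis by simp
    qed
    finally show ?thesis .
  qed
  moreover have "?s \<longlonglongrightarrow> ?Q + 2 * t * ?g + t\<^sup>2 * (1 * C0 \<rho> k + 0 * M)"
  proof -
    have "(\<lambda>r. real r * inverse (real (Suc r))) \<longlonglongrightarrow> 1"
      using LIMSEQ_n_over_Suc_n by (simp add: divide_inverse)
    then show ?thesis by (intro tendsto_intros LIMSEQ_inverse_real_of_nat)
  qed
  ultimately show ?thesis using LIMSEQ_le_const[of ?s _ 0] by auto
qed

lemma C0_nonneg: "0 \<le> C0 \<rho> k"
  using quad_form_mean_nonneg[of 0 "\<lambda>_. 0" "\<lambda>_. 0" 1] by (simp add: quad_form_def)

text \<open>The weights \<open>1\<close> and \<open>-1\<close> at two points bound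
  \<open>k x y\<close> by the mean of the diagonal values; this is integrated in both variables. The
  result makes the weights \<open>gamma_hat\<close> summable.\<close>

lemma C0_le_M: "C0 \<rho> k \<le> M"
proof -
  have "k x y \<le> (k x x + k y y) / 2" if "x \<in> D" "y \<in> D" for x y
    using pd_kernel_insert_nonneg[OF k_kernel, of 1 "\<lambda>_. x" y "\<lambda>_. 1" "-1"] that
    by (simp add: quad_form_def)
  then have "mean x \<le> (\<integral>y. (k x x + k y y) / 2 \<partial>\<rho>)" if "x \<in> D" for x
    unfolding mean_def using that integrable_section M_finite
    by (intro integral_mono) (auto simp: space_rho)
  then have "mean x \<le> (k x x + M) / 2" if "x \<in> D" for x
    using that M_finite by (simp add: prob_space)
  then have "(\<integral>x. mean x \<partial>\<rho>) \<le> (\<integral>x. (k x x + M) / 2 \<partial>\<rho>)"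
    using integrable_mean M_finite by (intro integral_mono) (auto simp: space_rho)
  then show ?thesis using M_finite by (simp add: prob_space integral_mean)
qed

text \<open>By Aronszajn's criterion this bounds the squared norm of \<open>mean\<close> in the
  space of \<open>k\<close> by \<open>C0 \<rho> k\<close>. It is the discriminant condition for the
  polynomial in \<open>quad_form_mean_nonneg\<close>.\<close>

lemma pd_kernel_minus_mean: "pd_kernel D (\<lambda>x y. C0 \<rho> k * k x y - mean x * mean y)"
proof (rule pd_kernelI)
  fix n and xs :: "nat \<Rightarrow> real" and c :: "nat \<Rightarrow> real"
  assume "\<And>i. i < n \<Longrightarrow> xs i \<in> D"
  then have "(\<Sum>i<n. c i * mean (xs i))\<^sup>2 \<le> quad_form k n c xs * C0 \<rho> k"
    by (intro square_le_of_quadratic_nonneg quad_form_mean_nonneg C0_nonneg)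
  then show "0 \<le> quad_form (\<lambda>x y. C0 \<rho> k * k x y - mean x * mean y) n c xs"
    by (simp add: quad_form_diff quad_form_scale quad_form_rank_one mult.commute)
qed (use pd_kernelD_sym[OF k_kernel] in auto)

end

section \<open>The weighted kernel and its function space\<close>

lemma has_sum_finite_sum:
  fixes f :: "'i \<Rightarrow> 'a \<Rightarrow> real"
  assumes "finite I" "\<And>i. i \<in> I \<Longrightarrow> (f i has_sum s i) A"
  shows "((\<lambda>x. \<Sum>i\<in>I. f i x) has_sum (\<Sum>i\<in>I. s i)) A"
  using assms by (induction I) (auto intro: has_sum_add has_sum_0)

lemma rkhs_ball_iff:
  "f \<in> rkhs_ball S K \<longleftrightarrow> (\<forall>x. x \<notin> S \<longrightarrow> f x = 0) \<and>
    (\<forall>n (xs::nat \<Rightarrow> 'a) c. (\<forall>i<n. xs i \<in> S) \<longrightarrow> (\<Sum>i<n. c i * f (xs i))\<^sup>2 \<le> quad_form K n c xs)"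
  by (simp add: rkhs_ball_def quad_form_def)

lemma rkhs_iff:
  "f \<in> rkhs S K \<longleftrightarrow> (\<forall>x. x \<notin> S \<longrightarrow> f x = 0) \<and>
    (\<exists>C. \<forall>n (xs::nat \<Rightarrow> 'a) c. (\<forall>i<n. xs i \<in> S) \<longrightarrow>
      (\<Sum>i<n. c i * f (xs i))\<^sup>2 \<le> C * quad_form K n c xs)"
  by (simp add: rkhs_def quad_form_def)

lemma rkhs_ball_subset_rkhs: "rkhs_ball S K \<subseteq> rkhs S K"
proof
  fix f assume "f \<in> rkhs_ball S K"
  then show "f \<in> rkhs S K"
    unfolding rkhs_ball_iff rkhs_iff by (intro conjI exI[of _ 1]) auto
qed

lemma rkhs_ball_uminus: "f \<in> rkhs_ball S K \<Longrightarrow> (\<lambda>x. - f x) \<in> rkhs_ball S K"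
  by (simp add: rkhs_ball_iff sum_negf)

lemma zero_in_rkhs_ball: "pd_kernel S K \<Longrightarrow> (\<lambda>x. 0) \<in> rkhs_ball S K"
  by (auto simp: rkhs_ball_iff intro!: pd_kernelD)

text \<open>The defining inequality is tested at the single point \<open>x\<close>. At the anchor it
  shows that every function of the univariate space vanishes there.\<close>

lemma rkhs_eq_zero:
  assumes f: "f \<in> rkhs S K" and x: "x \<in> S" "K x x = 0"
  shows "f x = 0"
proof -
  from f obtain C where C: "\<And>n xs c. (\<forall>i<n. xs i \<in> S) \<Longrightarrow>
      (\<Sum>i<n. c i * f (xs i))\<^sup>2 \<le> C * quad_form K n c (xs :: nat \<Rightarrow> _)"
    unfolding rkhs_iff by blast
  from C[of 1 "\<lambda>_. x" "\<lambda>_. 1"] show ?thesis using x by (simp add: quad_form_def)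
qed

section \<open>The anchored setting on the infinite product space\<close>

locale anchored_kernel = kernel_prob_space +
  fixes a :: real and \<gamma> :: "nat set \<Rightarrow> real"
  assumes anchor: "a \<in> D" "k a a = 0"
    and gamma_nonneg: "\<And>u. finite u \<Longrightarrow> \<gamma> u \<ge> 0"
    and gamma_summable: "(\<lambda>u. \<gamma> u * M ^ card u) summable_on {u. finite u}"
    and C0_pos: "C0 \<rho> k > 0"
begin

abbreviation PX :: "(nat \<Rightarrow> real) measure" where "PX \<equiv> PiM UNIV (\<lambda>_. \<rho>)"
abbreviation X :: "(nat \<Rightarrow> real) set" where "X \<equiv> Xdom D \<gamma> k"
abbreviation ghat :: "nat set \<Rightarrow> real" where "ghat \<equiv> gamma_hat \<rho> k \<gamma>"

sublocale PX: product_prob_space "\<lambda>_::nat. \<rho>" UNIV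
  by unfold_locales

lemma k_anchor: "y \<in> D \<Longrightarrow> k a y = 0"
  using pd_kernel_Cauchy_Schwarz[OF k_kernel anchor(1), of y] anchor(2) by simp

lemma mean_anchor: "mean a = 0"
proof -
  have "mean a = (\<integral>y. 0 \<partial>\<rho>)"
    unfolding mean_def by (intro Bochner_Integration.integral_cong) (auto simp: space_rho k_anchor)
  then show ?thesis by simp
qed

lemma space_PX: "space PX = {x. \<forall>j. x j \<in> D}"
  by (auto simp: space_PiM space_rho)

lemma XD: "x \<in> X \<Longrightarrow> x j \<in> D"
  by (simp add: Xdom_def)

lemma kprod_diag_nonneg: "\<forall>j. x j \<in> D \<Longrightarrow> 0 \<le> kprod k u x x"
  unfolding kprod_def by (intro prod_nonneg) (auto intro: pd_kernel_diag_nonneg[OF k_kernel])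

lemma ghat_nonneg: "finite u \<Longrightarrow> 0 \<le> ghat u"
  using gamma_nonneg C0_pos by (simp add: gamma_hat_def)

lemma ghat_summable: "ghat summable_on {u. finite u}"
proof (rule summable_on_comparison_test[OF gamma_summable])
  fix u :: "nat set" assume "u \<in> {u. finite u}"
  then show "ghat u \<le> \<gamma> u * M ^ card u"
    unfolding gamma_hat_def using gamma_nonneg C0_pos C0_le_M
    by (intro mult_left_mono power_mono) auto
qed (simp add: ghat_nonneg)

text \<open>Only the coordinates in \<open>u\<close> matter, so the integral is pushed forward to
  the finite product, where it factorises.\<close>

lemma product_integral:
  fixes h :: "real \<Rightarrow> real"
  assumes u: "finite u" and h: "integrable \<rho> h"
  shows "integrable PX (\<lambda>x. \<Prod>j\<in>u. h (x j))"
    and "(\<integral>x. (\<Prod>j\<in>u. h (x j)) \<partial>PX) = (\<integral>x. h x \<partial>\<rho>) ^ card u"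
proof -
  let ?r = "\<lambda>x::nat \<Rightarrow> real. restrict x u"
  let ?g = "\<lambda>x::nat \<Rightarrow> real. \<Prod>j\<in>u. h (x j)"
  have distr: "distr PX (PiM u (\<lambda>_. \<rho>)) ?r = PiM u (\<lambda>_. \<rho>)"
    using u by (rule PX.distr_PiM_restrict_finite) simp
  have r: "?r \<in> PX \<rightarrow>\<^sub>M PiM u (\<lambda>_. \<rho>)" by (rule measurable_restrict_subset) simp
  have g: "integrable (PiM u (\<lambda>_. \<rho>)) ?g"
    using u h by (rule PX.product_integrable_prod)
  then have gm: "?g \<in> borel_measurable (PiM u (\<lambda>_. \<rho>))" by simp
  have eq: "?g (?r x) = ?g x" for x by (intro prod.cong) auto
  show "integrable PX ?g"
    using g integrable_distr_eq[OF r gm] by (simp add: distr eq cong: prod.cong)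
  have "(\<integral>x. ?g x \<partial>PX) = (\<integral>x. ?g x \<partial>PiM u (\<lambda>_. \<rho>))"
    using integral_distr[OF r gm] by (simp add: distr eq cong: prod.cong)
  also have "\<dots> = (\<Prod>j\<in>u. (\<integral>x. h x \<partial>\<rho>))"
    using u h by (rule PX.product_integral_prod)
  finally show "(\<integral>x. ?g x \<partial>PX) = (\<integral>x. h x \<partial>\<rho>) ^ card u" by simp
qed

text \<open>Membership in \<open>X\<close> is finiteness of a series of nonnegative measurable
  terms. By monotone convergence its integral is the sum of \<open>\<gamma> u * M ^ card u\<close>,
  which is finite, so \<open>X\<close> has full measure.\<close>

lemma X_measurable: "X \<in> sets PX" and AE_X: "AE x in PX. x \<in> X"
proof -
  \<comment> \<open>Enumerating the finite sets turns the unordered sums into ordinary series of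
    \<open>ennreal\<close> terms, for which sum and integral can be exchanged.\<close>
  define e where "e = from_nat_into {u::nat set. finite u}"
  have inf: "infinite {u::nat set. finite u}"
    by (rule infinite_super[of "range (\<lambda>n::nat. {n})"]) (auto intro!: range_inj_infinite injI)
  have e: "bij_betw e UNIV {u. finite u}"
    unfolding e_def using countable_Collect_finite inf by (rule bij_betw_from_nat_into)
  then have fin: "finite (e n)" for n by (auto simp: bij_betw_def)
  let ?t = "\<lambda>n x. \<gamma> (e n) * kprod k (e n) x x"
  have t_nonneg: "0 \<le> ?t n x" if "\<forall>j. x j \<in> D" for n x
    using kprod_diag_nonneg[OF that] gamma_nonneg[OF fin] by simp
  have t_int: "integrable PX (?t n)" "(\<integral>x. ?t n x \<partial>PX) = \<gamma> (e n) * M ^ card (e n)" for n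
    using product_integral[OF fin M_finite, of n] by (simp_all add: kprod_def)
  have [measurable]: "?t n \<in> borel_measurable PX" for n
    using t_int(1) by (rule borel_measurable_integrable)
  have X_eq: "x \<in> X \<longleftrightarrow> (\<Sum>n. ennreal (?t n x)) \<noteq> \<infinity>" if x: "x \<in> space PX" for x
  proof -
    have D: "\<forall>j. x j \<in> D" using x space_PX by auto
    have "x \<in> X \<longleftrightarrow> (\<lambda>u. \<gamma> u * kprod k u x x) summable_on {u. finite u}"
      using D by (simp add: Xdom_def)
    also have "\<dots> \<longleftrightarrow> (\<lambda>n. ?t n x) summable_on UNIV"
      by (rule summable_on_reindex_bij_betw[OF e, symmetric])
    also have "\<dots> \<longleftrightarrow> summable (\<lambda>n. ?t n x)"
      by (rule summable_on_UNIV_nonneg_real_iff) (rule t_nonneg[OF D])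
    also have "\<dots> \<longleftrightarrow> (\<Sum>n. ennreal (?t n x)) \<noteq> \<infinity>"
      using summable_suminf_not_top[of "\<lambda>n. ?t n x"] ennreal_suminf_neq_top[of "\<lambda>n. ?t n x"]
        t_nonneg[OF D] unfolding infinity_ennreal_def by blast
    finally show ?thesis .
  qed
  have "X = {x \<in> space PX. (\<Sum>n. ennreal (?t n x)) \<noteq> \<infinity>}"
    using X_eq by (auto simp: space_PX dest: XD)
  also have "\<dots> \<in> sets PX" by measurable
  finally show "X \<in> sets PX" .
  have "(\<integral>\<^sup>+x. (\<Sum>n. ennreal (?t n x)) \<partial>PX) = (\<Sum>n. \<integral>\<^sup>+x. ennreal (?t n x) \<partial>PX)"
    by (rule nn_integral_suminf) measurable
  also have "\<dots> = (\<Sum>n. ennreal (\<gamma> (e n) * M ^ card (e n)))"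
  proof (rule suminf_cong)
    fix n
    have "AE x in PX. 0 \<le> ?t n x" using t_nonneg by (intro AE_I2) (simp add: space_PX)
    from nn_integral_eq_integral[OF t_int(1) this]
    show "(\<integral>\<^sup>+x. ennreal (?t n x) \<partial>PX) = ennreal (\<gamma> (e n) * M ^ card (e n))"
      unfolding t_int(2) .
  qed
  also have "\<dots> \<noteq> \<infinity>"
  proof -
    have nonneg: "0 \<le> \<gamma> (e n) * M ^ card (e n)" for n
      using gamma_nonneg[OF fin] C0_nonneg C0_le_M by (intro mult_nonneg_nonneg) auto
    have "(\<lambda>n. \<gamma> (e n) * M ^ card (e n)) summable_on UNIV"
      using gamma_summable summable_on_reindex_bij_betw[OF e, of "\<lambda>u. \<gamma> u * M ^ card u"] by simp
    then have "summable (\<lambda>n. \<gamma> (e n) * M ^ card (e n))"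
      using nonneg by (simp add: summable_on_UNIV_nonneg_real_iff)
    then show ?thesis
      unfolding infinity_ennreal_def using nonneg by (rule ennreal_suminf_neq_top)
  qed
  finally have "AE x in PX. (\<Sum>n. ennreal (?t n x)) \<noteq> \<infinity>"
    by (intro nn_integral_noteq_infinite) measurable
  then show "AE x in PX. x \<in> X"
    using AE_space by eventually_elim (use X_eq in blast)
qed

text \<open>The terms are dominated by the two diagonal families, which are summable by the
  definition of \<open>X\<close>. Hence \<open>Kgamma\<close> is a genuine sum on \<open>X\<close>
  and not the default value of \<open>infsum\<close>.\<close>

lemma Kgamma_has_sum:
  assumes x: "x \<in> X" and y: "y \<in> X"
  shows "((\<lambda>u. \<gamma> u * kprod k u x y) has_sum Kgamma \<gamma> k x y) {u. finite u}"
proof -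
  have "(\<lambda>u. \<gamma> u * kprod k u x x + \<gamma> u * kprod k u y y) summable_on {u. finite u}"
    using x y by (intro summable_on_add) (auto simp: Xdom_def)
  then have "(\<lambda>u. norm (\<gamma> u * kprod k u x y)) summable_on {u. finite u}"
  proof (rule Infinite_Sum.abs_summable_on_comparison_test')
    fix u :: "nat set" assume "u \<in> {u. finite u}"
    then have u: "finite u" by simp
    have "\<bar>kprod k u x y\<bar> \<le> kprod k u x x + kprod k u y y"
      using x y by (intro pd_kernel_abs_le[OF pd_kernel_kprod[OF k_kernel u]]) (auto simp: Xdom_def)
    then show "norm (\<gamma> u * kprod k u x y) \<le> \<gamma> u * kprod k u x x + \<gamma> u * kprod k u y y"
      using gamma_nonneg[OF u] by (simp add: abs_mult mult_left_mono flip: distrib_left)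
  qed
  then show ?thesis unfolding Kgamma_def by (rule has_sum_infsum[OF abs_summable_summable])
qed

text \<open>Each omitted set contributes a nonnegative form. The choice \<open>F = {}\<close> gives
  positive semidefiniteness of \<open>Kgamma\<close>, and \<open>F = {{0}}\<close> the embedding of
  the univariate space.\<close>

lemma quad_form_Kgamma_ge:
  assumes F: "finite F" "\<And>u. u \<in> F \<Longrightarrow> finite u" and xs: "\<And>i. i < n \<Longrightarrow> xs i \<in> X"
  shows "(\<Sum>u\<in>F. \<gamma> u * quad_form (kprod k u) n c xs) \<le> quad_form (Kgamma \<gamma> k) n c xs"
proof (rule finite_sum_le_has_sum)
  have "((\<lambda>u. \<Sum>i<n. \<Sum>j<n. c i * c j * (\<gamma> u * kprod k u (xs i) (xs j))) has_sum
      quad_form (Kgamma \<gamma> k) n c xs) {u. finite u}"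
    unfolding quad_form_def using xs
    by (intro has_sum_finite_sum has_sum_cmult_right Kgamma_has_sum) auto
  moreover have "(\<lambda>u. \<Sum>i<n. \<Sum>j<n. c i * c j * (\<gamma> u * kprod k u (xs i) (xs j))) =
      (\<lambda>u. \<gamma> u * quad_form (kprod k u) n c xs)"
    by (simp add: quad_form_def sum_distrib_left mult.left_commute mult.assoc)
  ultimately show "((\<lambda>u. \<gamma> u * quad_form (kprod k u) n c xs) has_sum
      quad_form (Kgamma \<gamma> k) n c xs) {u. finite u}" by simp
  fix u :: "nat set" assume "u \<in> {u. finite u} - F"
  then show "0 \<le> \<gamma> u * quad_form (kprod k u) n c xs"
    using gamma_nonneg xs by (auto intro!: mult_nonneg_nonneg pd_kernelD[OF pd_kernel_kprod[OF k_kernel]] dest: XD)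
qed (use F in auto)

lemma pd_kernel_Kgamma: "pd_kernel X (Kgamma \<gamma> k)"
proof (rule pd_kernelI)
  fix x y assume "x \<in> X" "y \<in> X"
  then show "Kgamma \<gamma> k x y = Kgamma \<gamma> k y x"
    unfolding Kgamma_def kprod_def using pd_kernelD_sym[OF k_kernel XD XD]
    by (intro infsum_cong arg_cong2[where f = "(*)"] prod.cong) auto
qed (use quad_form_Kgamma_ge[of "{}"] in auto)

lemma zero_in_Bgamma: "(\<lambda>x. 0) \<in> Bgamma D \<gamma> k"
  unfolding Bgamma_def by (rule zero_in_rkhs_ball[OF pd_kernel_Kgamma])

lemma Bgamma_subset_Hgamma: "Bgamma D \<gamma> k \<subseteq> Hgamma D \<gamma> k"
  unfolding Bgamma_def Hgamma_def by (rule rkhs_ball_subset_rkhs)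

text \<open>If the weights in \<open>F\<close> sum to \<open>0\<close>, the denominator is
  \<open>0\<close> and, by the convention on division, so is the function.\<close>

definition fooling :: "nat set set \<Rightarrow> (nat \<Rightarrow> real) \<Rightarrow> real" where
  "fooling F x = (if x \<in> X then (\<Sum>u\<in>F. \<gamma> u * (\<Prod>j\<in>u. mean (x j))) / sqrt (\<Sum>u\<in>F. ghat u) else 0)"

section \<open>Norm, integral and zeros of the fooling functions\<close>

context
  fixes F :: "nat set set"
  assumes F: "finite F" "\<And>u. u \<in> F \<Longrightarrow> finite u"
begin

text \<open>Cauchy-Schwarz over the sets in \<open>F\<close>: one factor is the normalising sum, the
  other is bounded termwise by \<open>pd_kernel_kprod_minus_rank_one\<close> and then by the form of
  \<open>Kgamma\<close>.\<close>

lemma fooling_in_Bgamma: "fooling F \<in> Bgamma D \<gamma> k"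
  unfolding Bgamma_def rkhs_ball_iff
proof (intro conjI allI impI)
  fix n and xs :: "nat \<Rightarrow> nat \<Rightarrow> real" and c :: "nat \<Rightarrow> real"
  assume "\<forall>i<n. xs i \<in> X"
  then have xs: "\<And>i. i < n \<Longrightarrow> xs i \<in> X" by blast
  let ?S = "\<Sum>u\<in>F. ghat u"
  define g where "g u = (\<Sum>i<n. c i * (\<Prod>j\<in>u. mean (xs i j)))" for u
  have S: "0 \<le> ?S" using ghat_nonneg F by (intro sum_nonneg) auto
  have g: "(g u)\<^sup>2 \<le> C0 \<rho> k ^ card u * quad_form (kprod k u) n c xs" if "u \<in> F" for u
  proof -
    have "0 \<le> quad_form (\<lambda>x y. C0 \<rho> k ^ card u * kprod k u x y -
        (\<Prod>j\<in>u. mean (x j)) * (\<Prod>j\<in>u. mean (y j))) n c xs"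
      using xs F(2)[OF that]
      by (intro pd_kernelD[OF pd_kernel_kprod_minus_rank_one[OF k_kernel C0_nonneg pd_kernel_minus_mean]])
        (auto dest: XD)
    then show ?thesis by (simp add: quad_form_diff quad_form_scale quad_form_rank_one[where g = "\<lambda>x. \<Prod>j\<in>u. mean (x j)"] g_def)
  qed
  \<comment> \<open>The weight is split so that the first factor squares to \<open>ghat u\<close>
    and the square of the second cancels the power of \<open>C0\<close> in the bound on
    \<open>g u\<close>.\<close>
  have "(\<Sum>u\<in>F. \<gamma> u * g u)\<^sup>2 = (\<Sum>u\<in>F. sqrt (ghat u) * (sqrt (\<gamma> u / C0 \<rho> k ^ card u) * g u))\<^sup>2"
  proof -
    have "sqrt (ghat u) * sqrt (\<gamma> u / C0 \<rho> k ^ card u) = \<gamma> u" if "u \<in> F" for u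
      using gamma_nonneg[OF F(2)[OF that]] C0_pos
      by (simp add: gamma_hat_def flip: real_sqrt_mult)
    then show ?thesis by (simp flip: mult.assoc)
  qed
  also have "\<dots> \<le> (\<Sum>u\<in>F. (sqrt (ghat u))\<^sup>2) * (\<Sum>u\<in>F. (sqrt (\<gamma> u / C0 \<rho> k ^ card u) * g u)\<^sup>2)"
    by (rule Cauchy_Schwarz_ineq_sum)
  also have "(\<Sum>u\<in>F. (sqrt (ghat u))\<^sup>2) = ?S"
    using ghat_nonneg F by (intro sum.cong) auto
  also have "(\<Sum>u\<in>F. (sqrt (\<gamma> u / C0 \<rho> k ^ card u) * g u)\<^sup>2) \<le> (\<Sum>u\<in>F. \<gamma> u * quad_form (kprod k u) n c xs)"
  proof (rule sum_mono)
    fix u assume u: "u \<in> F"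
    have \<gamma>: "0 \<le> \<gamma> u" by (rule gamma_nonneg[OF F(2)[OF u]])
    have "(sqrt (\<gamma> u / C0 \<rho> k ^ card u) * g u)\<^sup>2 = \<gamma> u / C0 \<rho> k ^ card u * (g u)\<^sup>2"
      using \<gamma> C0_pos by (simp add: power_mult_distrib)
    also have "\<dots> \<le> \<gamma> u / C0 \<rho> k ^ card u * (C0 \<rho> k ^ card u * quad_form (kprod k u) n c xs)"
      using \<gamma> C0_pos by (intro mult_left_mono g[OF u]) auto
    also have "\<dots> = \<gamma> u * quad_form (kprod k u) n c xs" using C0_pos by simp
    finally show "(sqrt (\<gamma> u / C0 \<rho> k ^ card u) * g u)\<^sup>2 \<le> \<gamma> u * quad_form (kprod k u) n c xs" .
  qed
  also have "\<dots> \<le> quad_form (Kgamma \<gamma> k) n c xs" by (rule quad_form_Kgamma_ge[OF F xs])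
  finally have *: "(\<Sum>u\<in>F. \<gamma> u * g u)\<^sup>2 \<le> ?S * quad_form (Kgamma \<gamma> k) n c xs"
    using S by (simp add: mult_left_mono)
  have "(\<Sum>i<n. c i * fooling F (xs i)) = (\<Sum>i<n. \<Sum>u\<in>F. \<gamma> u * (c i * (\<Prod>j\<in>u. mean (xs i j)))) / sqrt ?S"
    using xs by (simp add: fooling_def sum_divide_distrib sum_distrib_left mult.left_commute)
  also have "(\<Sum>i<n. \<Sum>u\<in>F. \<gamma> u * (c i * (\<Prod>j\<in>u. mean (xs i j)))) = (\<Sum>u\<in>F. \<gamma> u * g u)"
    by (subst sum.swap) (simp add: g_def sum_distrib_left)
  finally have "(\<Sum>i<n. c i * fooling F (xs i))\<^sup>2 = (\<Sum>u\<in>F. \<gamma> u * g u)\<^sup>2 / ?S"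
    using S by (simp add: power_divide)
  also have "\<dots> \<le> quad_form (Kgamma \<gamma> k) n c xs"
  proof (cases "?S = 0")
    case True
    then show ?thesis using pd_kernelD[OF pd_kernel_Kgamma xs] by simp
  next
    case False
    then show ?thesis using S * by (simp add: divide_le_eq mult.commute)
  qed
  finally show "(\<Sum>i<n. c i * fooling F (xs i))\<^sup>2 \<le> quad_form (Kgamma \<gamma> k) n c xs" .
qed (simp add: fooling_def)

text \<open>The cut-off to \<open>X\<close> affects only a null set, and the numerator integrates to
  the sum under the root in the denominator.\<close>

lemma Iint_fooling: "Iint \<rho> (fooling F) = sqrt (\<Sum>u\<in>F. ghat u)"
proof -
  let ?S = "\<Sum>u\<in>F. ghat u" and ?h = "\<lambda>x. \<Sum>u\<in>F. \<gamma> u * (\<Prod>j\<in>u. mean (x j))"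
  have int: "integrable PX (\<lambda>x. \<Prod>j\<in>u. mean (x j))" "(\<integral>x. (\<Prod>j\<in>u. mean (x j)) \<partial>PX) = C0 \<rho> k ^ card u"
    if "u \<in> F" for u
    using product_integral[OF F(2)[OF that] integrable_mean] by (simp_all add: integral_mean)
  have h: "integrable PX ?h" "(\<integral>x. ?h x \<partial>PX) = ?S"
    using int by (auto simp: gamma_hat_def)
  have "Iint \<rho> (fooling F) = (\<integral>x. ?h x / sqrt ?S \<partial>PX)"
    unfolding Iint_def
  proof (rule integral_cong_AE)
    have "fooling F = (\<lambda>x. if x \<in> X then ?h x / sqrt ?S else 0)" by (auto simp: fooling_def)
    moreover have "(\<lambda>x. if x \<in> X then ?h x / sqrt ?S else 0) \<in> borel_measurable PX"
      using h(1) X_measurable by measurable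
    ultimately show "fooling F \<in> borel_measurable PX" by simp
    show "AE x in PX. fooling F x = ?h x / sqrt ?S"
      using AE_X by eventually_elim (simp add: fooling_def)
  qed (use h(1) in simp)
  also have "\<dots> = ?S / sqrt ?S" using h by simp
  also have "\<dots> = sqrt ?S"
    using ghat_nonneg F by (intro real_div_sqrt sum_nonneg) auto
  finally show ?thesis .
qed

lemma fooling_eq_0:
  assumes x: "x \<in> Xva D a v" and v: "\<And>u. u \<in> F \<Longrightarrow> \<not> u \<subseteq> v"
  shows "fooling F x = 0"
proof -
  have "(\<Prod>j\<in>u. mean (x j)) = 0" if u: "u \<in> F" for u
  proof -
    obtain j where "j \<in> u" "j \<notin> v" using v[OF u] by blast
    then show ?thesis using x F(2)[OF u] mean_anchor by (auto simp: Xva_def intro!: prod_zero)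
  qed
  then show ?thesis by (simp add: fooling_def)
qed

end

end

section \<open>The cost of escaping the fooling functions\<close>

lemma alg_vals_cong:
  assumes "\<And>i. i < n \<Longrightarrow> f (fst A (alg_vals A g i)) = g (fst A (alg_vals A g i))"
  shows "alg_vals A f n = alg_vals A g n"
  using assms by (induction n) auto

text \<open>An adaptive run is determined by the values it sees. If \<open>f\<close> and
  \<open>g\<close> agree at the points visited on \<open>g\<close>, the histories coincide up to the
  stopping time, and so do stopping time and output.\<close>

lemma alg_out_cong:
  assumes stops: "alg_stops A g"
    and eq: "\<And>i. i < alg_nevals A g \<Longrightarrow> f (fst A (alg_vals A g i)) = g (fst A (alg_vals A g i))"
  shows "alg_out A f = alg_out A g"
proof -
  let ?n = "alg_nevals A g"
  have vals: "alg_vals A f m = alg_vals A g m" if "m \<le> ?n" for m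
    using eq that by (intro alg_vals_cong) auto
  have stop: "fst (snd A) (alg_vals A g ?n)"
    using stops unfolding alg_stops_def alg_nevals_def by (rule LeastI_ex)
  have "alg_nevals A f = ?n"
    unfolding alg_nevals_def[of A f]
  proof (rule Least_equality)
    show "fst (snd A) (alg_vals A f ?n)" using stop vals by simp
    fix m assume m: "fst (snd A) (alg_vals A f m)"
    show "?n \<le> m"
    proof (rule ccontr)
      assume "\<not> ?n \<le> m"
      then have "fst (snd A) (alg_vals A g m)" "m < ?n" using m vals by auto
      then show False unfolding alg_nevals_def[of A g] using not_less_Least by blast
    qed
  qed
  moreover have "alg_stops A f" using stop vals unfolding alg_stops_def by (intro exI[of _ ?n]) simp
  ultimately show ?thesis using stops vals by (simp add: alg_out_def)
qed

lemma alg_cost_less_topD: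
  assumes "alg_cost c A f < N"
  shows "alg_stops A f" "(\<Sum>i<alg_nevals A f. c (fst A (alg_vals A f i))) < N"
  using assms by (auto simp: alg_cost_def split: if_splits)

lemma err_sq_le:
  assumes "wc_error I \<Omega> Q F \<le> ennreal \<epsilon>" "0 \<le> \<epsilon>" "f \<in> F"
  shows "(\<integral>\<^sup>+ \<omega>. ennreal ((I f - alg_out (Q \<omega>) f)\<^sup>2) \<partial>\<Omega>) \<le> ennreal (\<epsilon>\<^sup>2)"
proof -
  let ?e = "err_sq I \<Omega> Q F"
  have fin: "?e \<noteq> top" using assms(1) by (auto simp: wc_error_def top_unique split: if_splits)
  then have "sqrt (enn2real ?e) \<le> \<epsilon>"
    using assms(1,2) by (simp add: wc_error_def ennreal_le_iff)
  then have "(sqrt (enn2real ?e))\<^sup>2 \<le> \<epsilon>\<^sup>2" by (intro power_mono) auto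
  then have "enn2real ?e \<le> \<epsilon>\<^sup>2" by simp
  then have "ennreal (enn2real ?e) \<le> ennreal (\<epsilon>\<^sup>2)" by (rule ennreal_leI)
  then have "?e \<le> ennreal (\<epsilon>\<^sup>2)" using fin by (simp add: ennreal_enn2real_if)
  moreover have "(\<integral>\<^sup>+ \<omega>. ennreal ((I f - alg_out (Q \<omega>) f)\<^sup>2) \<partial>\<Omega>) \<le> ?e"
    unfolding err_sq_def using assms(3) by (rule SUP_upper)
  ultimately show ?thesis by (rule order_trans[rotated])
qed

lemma nested_seq_mono: "nested_seq v \<Longrightarrow> i \<le> j \<Longrightarrow> v i \<subseteq> v j"
  using lift_Suc_mono_le[of v i j] by (auto simp: nested_seq_def)

text \<open>Strict inclusions make the sizes grow with the index, so only finitely many sets of the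
  sequence stay below a given size.\<close>

lemma nested_seq_card_ge: "nested_seq v \<Longrightarrow> i \<le> card (v i)"
proof (induction i)
  case (Suc i)
  then have "card (v i) < card (v (Suc i))"
    by (intro psubset_card_mono) (auto simp: nested_seq_def)
  then show ?case using Suc by simp
qed simp

lemma prob_cost_less_ge_half:
  assumes "prob_space \<Omega>" and [measurable]: "T \<in> borel_measurable \<Omega>"
    and N: "(\<integral>\<^sup>+\<omega>. T \<omega> \<partial>\<Omega>) < ennreal N"
  shows "1/2 \<le> measure \<Omega> {\<omega> \<in> space \<Omega>. T \<omega> < ennreal (2 * N)}"
proof -
  interpret prob_space \<Omega> by fact
  let ?E = "{\<omega> \<in> space \<Omega>. \<not> T \<omega> < ennreal (2 * N)}"
  \<comment> \<open>\<open>ennreal N\<close> is \<open>0\<close> for nonpositive \<open>N\<close>,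
    which the strict bound on the integral excludes.\<close>
  have N_pos: "0 < N" using N by (cases "0 < N") (auto simp: ennreal_neg not_less)
  have "ennreal (2 * N * prob ?E) = (\<integral>\<^sup>+\<omega>. ennreal (2 * N) * indicator ?E \<omega> \<partial>\<Omega>)"
    using N_pos by (subst nn_integral_cmult_indicator) (auto simp: emeasure_eq_measure ennreal_mult)
  also have "\<dots> \<le> (\<integral>\<^sup>+\<omega>. T \<omega> \<partial>\<Omega>)"
    by (intro nn_integral_mono) (auto simp: indicator_def)
  also note N
  finally have "2 * N * prob ?E < N" using N_pos by (simp add: ennreal_less_iff)
  then have "prob ?E < 1/2" using N_pos by simp
  moreover have "prob ?E = 1 - prob {\<omega> \<in> space \<Omega>. T \<omega> < ennreal (2 * N)}"
    by (rule prob_neg) measurable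
  ultimately show ?thesis by simp
qed

section \<open>Tail bounds for the weights from a cheap and accurate algorithm\<close>

context anchored_kernel
begin

text \<open>On an event of probability at least \<open>1/2\<close> the outputs for both signs of the
  fooling function coincide, so there the squared errors add up to at least twice the sum of the
  weights. Their expectations add up to at most \<open>2 * \<epsilon>\<^sup>2\<close>, and the
  factor \<open>1/2\<close> yields the constant.\<close>

lemma sum_ghat_le_of_algorithm:
  assumes alg: "ran_alg \<Omega> Q (Hgamma D \<gamma> k) {c_nest dollar D a v | v. nested_seq v}"
    and err: "wc_error (Iint \<rho>) \<Omega> Q (Bgamma D \<gamma> k) \<le> ennreal \<epsilon>" and eps: "0 \<le> \<epsilon>"
    and v: "nested_seq v"
    and cost: "exp_cost (c_nest dollar D a v) \<Omega> Q (Bgamma D \<gamma> k) < ennreal N"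
    and F: "finite F" "\<And>u. u \<in> F \<Longrightarrow> finite u"
      "\<And>u. u \<in> F \<Longrightarrow> \<not> u \<subseteq> (\<Union>i\<in>{i. dollar (card (v i)) < ennreal (2 * N)}. v i)"
  shows "(\<Sum>u\<in>F. ghat u) \<le> 2 * \<epsilon>\<^sup>2"
proof -
  let ?c = "c_nest dollar D a v" and ?V = "\<Union>i\<in>{i. dollar (card (v i)) < ennreal (2 * N)}. v i"
  let ?f = "fooling F" and ?b = "sqrt (\<Sum>u\<in>F. ghat u)"
  interpret \<Omega>: prob_space \<Omega> using alg by (simp add: ran_alg_def)
  have meas: "(\<lambda>\<omega>. alg_out (Q \<omega>) f) \<in> borel_measurable \<Omega>"
      "(\<lambda>\<omega>. alg_cost ?c (Q \<omega>) f) \<in> borel_measurable \<Omega>" if "f \<in> Bgamma D \<gamma> k" for f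
    using alg that v Bgamma_subset_Hgamma by (auto simp: ran_alg_def)
  define E where "E = {\<omega> \<in> space \<Omega>. alg_cost ?c (Q \<omega>) (\<lambda>x. 0) < ennreal (2 * N)}"
  have E [measurable]: "E \<in> sets \<Omega>"
    unfolding E_def using meas(2)[OF zero_in_Bgamma] by measurable
  have "(\<integral>\<^sup>+\<omega>. alg_cost ?c (Q \<omega>) (\<lambda>x. 0) \<partial>\<Omega>) \<le> exp_cost ?c \<Omega> Q (Bgamma D \<gamma> k)"
    unfolding exp_cost_def using zero_in_Bgamma by (rule SUP_upper)
  then have half: "1/2 \<le> measure \<Omega> E"
    unfolding E_def using cost \<Omega>.prob_space_axioms meas(2)[OF zero_in_Bgamma]
    by (intro prob_cost_less_ge_half) (auto intro: le_less_trans)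
  have same: "alg_out (Q \<omega>) g = alg_out (Q \<omega>) (\<lambda>x. 0)"
    if \<omega>: "\<omega> \<in> E" and g: "\<And>x. x \<in> Xva D a ?V \<Longrightarrow> g x = 0" for \<omega> g
  proof (rule alg_out_cong)
    from \<omega> have T: "alg_cost ?c (Q \<omega>) (\<lambda>x. 0) < ennreal (2 * N)" by (simp add: E_def)
    show "alg_stops (Q \<omega>) (\<lambda>x. 0)" using alg_cost_less_topD(1)[OF T] by simp
    fix i assume i: "i < alg_nevals (Q \<omega>) (\<lambda>x. 0)"
    let ?x = "fst (Q \<omega>) (alg_vals (Q \<omega>) (\<lambda>x. 0) i)"
    \<comment> \<open>One evaluation costs no more than the whole run, so a set of the sequence with
      price below \<open>2 * N\<close> must already admit the point.\<close>
    have "?c ?x \<le> (\<Sum>i<alg_nevals (Q \<omega>) (\<lambda>x. 0). ?c (fst (Q \<omega>) (alg_vals (Q \<omega>) (\<lambda>x. 0) i)))"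
      using i by (intro member_le_sum) auto
    also have "\<dots> < ennreal (2 * N)" using alg_cost_less_topD(2)[OF T] by simp
    finally obtain j where "?x \<in> Xva D a (v j)" "dollar (card (v j)) < ennreal (2 * N)"
      unfolding c_nest_def by (auto simp: INF_less_iff)
    then have "?x \<in> Xva D a ?V" by (auto simp: Xva_def)
    then show "g ?x = 0" by (rule g)
  qed
  have out: "alg_out (Q \<omega>) ?f = alg_out (Q \<omega>) (\<lambda>x. 0)"
      "alg_out (Q \<omega>) (\<lambda>x. - ?f x) = alg_out (Q \<omega>) (\<lambda>x. 0)" if "\<omega> \<in> E" for \<omega>
    using fooling_eq_0[OF F(1,2) _ F(3)] by (auto intro!: same[OF that])
  have f: "?f \<in> Bgamma D \<gamma> k" "(\<lambda>x. - ?f x) \<in> Bgamma D \<gamma> k"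
    using fooling_in_Bgamma[OF F(1,2)] rkhs_ball_uminus by (auto simp: Bgamma_def)
  have I: "Iint \<rho> ?f = ?b" "Iint \<rho> (\<lambda>x. - ?f x) = - ?b"
    using Iint_fooling[OF F(1,2)] by (simp_all add: Iint_def)
  have b: "0 \<le> ?b" "?b\<^sup>2 = (\<Sum>u\<in>F. ghat u)"
    using F ghat_nonneg by (auto intro!: sum_nonneg)
  note [measurable] = meas(1)[OF f(1)] meas(1)[OF f(2)]
  have "ennreal (2 * ?b\<^sup>2 * measure \<Omega> E) = (\<integral>\<^sup>+\<omega>. ennreal (2 * ?b\<^sup>2) * indicator E \<omega> \<partial>\<Omega>)"
    by (subst nn_integral_cmult_indicator[OF E]) (simp add: \<Omega>.emeasure_eq_measure ennreal_mult)
  also have "\<dots> \<le> (\<integral>\<^sup>+\<omega>. ennreal ((Iint \<rho> ?f - alg_out (Q \<omega>) ?f)\<^sup>2) +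
      ennreal ((Iint \<rho> (\<lambda>x. - ?f x) - alg_out (Q \<omega>) (\<lambda>x. - ?f x))\<^sup>2) \<partial>\<Omega>)"
  proof (rule nn_integral_mono)
    fix \<omega>
    \<comment> \<open>The right-hand side equals
      \<open>2 * ?b\<^sup>2 + 2 * t\<^sup>2\<close>.\<close>
    have "2 * ?b\<^sup>2 \<le> (?b - t)\<^sup>2 + (- ?b - t)\<^sup>2" for t
      by (simp add: power2_eq_square algebra_simps)
    then show "ennreal (2 * ?b\<^sup>2) * indicator E \<omega> \<le> ennreal ((Iint \<rho> ?f - alg_out (Q \<omega>) ?f)\<^sup>2) +
      ennreal ((Iint \<rho> (\<lambda>x. - ?f x) - alg_out (Q \<omega>) (\<lambda>x. - ?f x))\<^sup>2)"
      unfolding I by (auto simp: indicator_def out simp del: b(2) simp flip: ennreal_plus intro!: ennreal_leI)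
  qed
  also have "\<dots> = (\<integral>\<^sup>+\<omega>. ennreal ((Iint \<rho> ?f - alg_out (Q \<omega>) ?f)\<^sup>2) \<partial>\<Omega>) +
      (\<integral>\<^sup>+\<omega>. ennreal ((Iint \<rho> (\<lambda>x. - ?f x) - alg_out (Q \<omega>) (\<lambda>x. - ?f x))\<^sup>2) \<partial>\<Omega>)"
    by (rule nn_integral_add) measurable
  also have "\<dots> \<le> ennreal (\<epsilon>\<^sup>2) + ennreal (\<epsilon>\<^sup>2)"
    by (intro add_mono err_sq_le[OF err eps] f)
  also have "\<dots> = ennreal (2 * \<epsilon>\<^sup>2)" by (simp flip: ennreal_plus)
  finally have le: "2 * ?b\<^sup>2 * measure \<Omega> E \<le> 2 * \<epsilon>\<^sup>2" by (simp add: ennreal_le_iff)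
  have "?b\<^sup>2 = 2 * ?b\<^sup>2 * (1/2)" by simp
  also have "\<dots> \<le> 2 * ?b\<^sup>2 * measure \<Omega> E" using half by (intro mult_left_mono) auto
  finally show ?thesis using le b(2) by linarith
qed

text \<open>Sets priced below \<open>2 * N\<close> have size \<open>O(N powr (1/s))\<close> by the
  growth of the price. The constant \<open>B\<close> is fixed before \<open>N\<close> and
  \<open>\<epsilon>\<close>, as is needed when \<open>\<epsilon>\<close> tends to
  \<open>0\<close>.\<close>

lemma comp_nest_tail_bound:
  fixes W :: "'w itself"
  assumes s: "0 < s"
    and growth: "\<exists>c>0. \<forall>\<^sub>F \<nu> in sequentially. dollar \<nu> \<ge> ennreal (c * real \<nu> powr s)"
  obtains B where "0 < B"
    "\<And>N \<epsilon>. 1 \<le> N \<Longrightarrow> 0 < \<epsilon> \<Longrightarrow> comp_nest W D k a \<rho> \<gamma> dollar \<epsilon> < ennreal N \<Longrightarrow>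
      \<exists>V. finite V \<and> real (card V) \<le> B * N powr (1/s) \<and>
        (\<forall>F. finite F \<longrightarrow> (\<forall>u\<in>F. finite u \<and> \<not> u \<subseteq> V) \<longrightarrow> (\<Sum>u\<in>F. ghat u) \<le> 2 * \<epsilon>\<^sup>2)"
proof -
  from growth obtain c \<nu>\<^sub>0 where c: "0 < c" and \<nu>\<^sub>0: "\<And>\<nu>. \<nu>\<^sub>0 \<le> \<nu> \<Longrightarrow> ennreal (c * real \<nu> powr s) \<le> dollar \<nu>"
    by (auto simp: eventually_sequentially)
  \<comment> \<open>The first summand covers the sizes below \<open>\<nu>\<^sub>0\<close>, the
    second comes from solving \<open>c * real \<nu> powr s < 2 * N\<close> for \<open>\<nu>\<close>,
    and the third makes \<open>B\<close> positive.\<close>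
  define B where "B = real \<nu>\<^sub>0 + (2 / c) powr (1/s) + 1"
  have card_le: "real \<nu> \<le> B * N powr (1/s)" if N: "1 \<le> N" and less: "dollar \<nu> < ennreal (2 * N)" for N \<nu>
  proof (cases "\<nu>\<^sub>0 \<le> \<nu>")
    case True
    have "ennreal (c * real \<nu> powr s) < ennreal (2 * N)" using \<nu>\<^sub>0[OF True] less by (rule le_less_trans)
    then have "real \<nu> powr s < 2 / c * N" using N c by (simp add: ennreal_less_iff field_simps)
    then have "(real \<nu> powr s) powr (1/s) \<le> (2 / c * N) powr (1/s)"
      using s by (intro powr_mono2) auto
    then have "real \<nu> \<le> (2 / c) powr (1/s) * N powr (1/s)"
      using s c N powr_mult[of "2 / c" N "1/s"] by (simp add: powr_powr)
    also have "\<dots> \<le> B * N powr (1/s)" by (intro mult_right_mono) (auto simp: B_def)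
    finally show ?thesis .
  next
    case False
    then have "real \<nu> \<le> B * 1" by (simp add: B_def add_increasing2)
    also have "\<dots> \<le> B * N powr (1/s)"
      using N s by (intro mult_left_mono ge_one_powr_ge_zero) (auto simp: B_def)
    finally show ?thesis .
  qed
  show ?thesis
  proof (rule that[of B])
    show "0 < B" by (simp add: B_def add_nonneg_pos)
    fix N \<epsilon> :: real assume N: "1 \<le> N" and eps: "0 < \<epsilon>"
    assume "comp_nest W D k a \<rho> \<gamma> dollar \<epsilon> < ennreal N"
    then obtain \<Omega> :: "'w measure" and Q v where
      alg: "ran_alg \<Omega> Q (Hgamma D \<gamma> k) {c_nest dollar D a v | v. nested_seq v}"
        "wc_error (Iint \<rho>) \<Omega> Q (Bgamma D \<gamma> k) \<le> ennreal \<epsilon>"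
      and v: "nested_seq v"
      and cost: "exp_cost (c_nest dollar D a v) \<Omega> Q (Bgamma D \<gamma> k) < ennreal N"
      unfolding comp_nest_def cost_nest_def by (auto simp: INF_less_iff)
    define J where "J = {i. dollar (card (v i)) < ennreal (2 * N)}"
    have J: "real (card (v i)) \<le> B * N powr (1/s)" if "i \<in> J" for i
      using that card_le[OF N] by (simp add: J_def)
    have "i \<le> nat \<lfloor>B * N powr (1/s)\<rfloor>" if "i \<in> J" for i
      using nested_seq_card_ge[OF v, of i] J[OF that] by linarith
    then have fin: "finite J" by (auto intro: finite_subset[of _ "{..nat \<lfloor>B * N powr (1/s)\<rfloor>}"])
    have "real (card (\<Union>i\<in>J. v i)) \<le> B * N powr (1/s)"
    proof (cases "J = {}")
      case True then show ?thesis by (simp add: B_def add_nonneg_nonneg)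
    next
      case False
      \<comment> \<open>Here nestedness enters: the union of all affordable sets is one of them, so
        it obeys the same bound on its size.\<close>
      then have "(\<Union>i\<in>J. v i) = v (Max J)"
        by (intro equalityI UN_least UN_upper nested_seq_mono[OF v] Max_ge Max_in fin)
      then show ?thesis using J[OF Max_in[OF fin False]] by simp
    qed
    moreover have "finite (\<Union>i\<in>J. v i)" using fin v by (auto simp: nested_seq_def)
    moreover have "(\<Sum>u\<in>F. ghat u) \<le> 2 * \<epsilon>\<^sup>2"
      if "finite F" "\<forall>u\<in>F. finite u \<and> \<not> u \<subseteq> (\<Union>i\<in>J. v i)" for F
      using sum_ghat_le_of_algorithm[OF alg less_imp_le[OF eps] v cost that(1)] that(2)
      unfolding J_def by blast
    ultimately show "\<exists>V. finite V \<and> real (card V) \<le> B * N powr (1/s) \<and>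
      (\<forall>F. finite F \<longrightarrow> (\<forall>u\<in>F. finite u \<and> \<not> u \<subseteq> V) \<longrightarrow> (\<Sum>u\<in>F. ghat u) \<le> 2 * \<epsilon>\<^sup>2)"
      by blast
  qed
qed

end

section \<open>Decay of the weights\<close>

text \<open>The elements are ranked by the number of their predecessors, ties being broken by \<open>to_nat_on\<close>.\<close>
lemma ex_decreasing_enumeration:
  fixes g :: "'a \<Rightarrow> real"
  assumes A: "countable A" "infinite A" and fin: "\<And>u. u \<in> A \<Longrightarrow> finite {w \<in> A. g u \<le> g w}"
  shows "\<exists>e::nat \<Rightarrow> 'a. bij_betw e UNIV A \<and> (\<forall>i j. i \<le> j \<longrightarrow> g (e j) \<le> g (e i))"
proof -
  define bef where "bef w u \<longleftrightarrow> g u < g w \<or> (g u = g w \<and> to_nat_on A w < to_nat_on A u)" for w u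
  define P where "P u = {w \<in> A. bef w u}" for u
  define r where "r u = card (P u)" for u
  have finP: "finite (P u)" if "u \<in> A" for u
    using fin[OF that] by (rule finite_subset[rotated]) (auto simp: P_def bef_def)
  have total: "bef w u \<or> bef u w" if "u \<in> A" "w \<in> A" "u \<noteq> w" for u w
  proof -
    have "to_nat_on A u \<noteq> to_nat_on A w"
      using that inj_on_to_nat_on[OF A(1)] by (simp add: inj_on_eq_iff)
    then show ?thesis unfolding bef_def by linarith
  qed
  have mono: "r w < r u" if "u \<in> A" "w \<in> A" "bef w u" for u w
  proof -
    have "P w \<subset> P u" using that by (auto simp: P_def bef_def)
    then show ?thesis unfolding r_def by (rule psubset_card_mono[OF finP[OF that(1)]])
  qed
  have inj: "inj_on r A"
    using total mono by (intro inj_onI) (metis less_irrefl)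
  \<comment> \<open>The \<open>r u\<close> predecessors of \<open>u\<close> have distinct ranks
    below \<open>r u\<close> and so take all these values; the ranks leave no gaps.\<close>
  have down: "{..<r u} \<subseteq> r ` A" if u: "u \<in> A" for u
  proof -
    have "r ` P u \<subseteq> {..<r u}" using mono[OF u] by (auto simp: P_def)
    moreover have "card (r ` P u) = card {..<r u}"
      using inj by (subst card_image) (auto simp: P_def r_def inj_on_def)
    ultimately have "r ` P u = {..<r u}" by (intro card_subset_eq) auto
    then show ?thesis by (auto simp: P_def)
  qed
  have "r ` A = UNIV"
  proof (rule equalityI)
    show "UNIV \<subseteq> r ` A"
    proof
      fix m :: nat
      have "infinite (r ` A)" using A(2) inj by (simp add: finite_image_iff)
      then obtain u where "u \<in> A" "m < r u" unfolding infinite_nat_iff_unbounded by blast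
      then show "m \<in> r ` A" using down by blast
    qed
  qed simp
  then have bij: "bij_betw r A UNIV" using inj by (simp add: bij_betw_def)
  let ?e = "inv_into A r"
  have e: "bij_betw ?e UNIV A" by (rule bij_betw_inv_into[OF bij])
  have re: "r (?e i) = i" and eA: "?e i \<in> A" for i
    using bij_betw_inv_into_right[OF bij] e by (auto simp: bij_betw_def)
  have "g (?e j) \<le> g (?e i)" if "i \<le> j" for i j
  proof (rule ccontr)
    assume "\<not> g (?e j) \<le> g (?e i)"
    then have "r (?e j) < r (?e i)" by (intro mono eA) (simp add: bef_def)
    then show False using re that by simp
  qed
  with e show ?thesis by blast
qed

text \<open>Each of the sizes \<open>0\<close> to \<open>\<sigma>\<close> contributes at most
  \<open>card v ^ \<sigma>\<close> subsets. Thus \<open>\<sigma>\<close> is itself a growth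
  exponent.\<close>

lemma card_subsets_le:
  assumes "finite v"
  shows "real (card {u \<in> wsets \<gamma> \<sigma>. u \<subseteq> v}) \<le> real (\<sigma> + 1) * real (card v) powr real \<sigma>"
proof (cases "v = {} \<or> \<sigma> = 0")
  case True
  \<comment> \<open>For empty \<open>v\<close> the right-hand side is \<open>0\<close>, as
    \<open>0 powr x = 0\<close>, and the count must vanish; it does because \<open>wsets\<close>
    excludes the empty set.\<close>
  then have "{u \<in> wsets \<gamma> \<sigma>. u \<subseteq> v} = {}" by (auto simp: wsets_def)
  then have "card {u \<in> wsets \<gamma> \<sigma>. u \<subseteq> v} = 0" by (simp only: card.empty)
  then show ?thesis by simp
next
  case False
  then have n: "1 \<le> card v" using assms by (simp add: Suc_le_eq card_gt_0_iff)
  have fin: "finite {u. u \<subseteq> v \<and> card u = i}" for i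
    by (rule finite_subset[of _ "Pow v"]) (use assms in auto)
  have "card {u \<in> wsets \<gamma> \<sigma>. u \<subseteq> v} \<le> card (\<Union>i\<in>{..\<sigma>}. {u. u \<subseteq> v \<and> card u = i})"
    by (intro card_mono) (auto simp: wsets_def fin)
  also have "\<dots> \<le> (\<Sum>i\<le>\<sigma>. card {u. u \<subseteq> v \<and> card u = i})" by (rule card_UN_le) simp
  also have "\<dots> \<le> (\<Sum>i\<le>\<sigma>. card v ^ \<sigma>)"
  proof (rule sum_mono)
    fix i assume "i \<in> {..\<sigma>}"
    have "card {u. u \<subseteq> v \<and> card u = i} = card v choose i" by (rule n_subsets[OF assms])
    also have "\<dots> \<le> card v ^ i"
      by (cases "i \<le> card v") (auto simp: binomial_le_pow binomial_eq_0)
    also have "\<dots> \<le> card v ^ \<sigma>" using \<open>i \<in> {..\<sigma>}\<close> n by (intro power_increasing) auto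
    finally show "card {u. u \<subseteq> v \<and> card u = i} \<le> card v ^ \<sigma>" .
  qed
  finally have "real (card {u \<in> wsets \<gamma> \<sigma>. u \<subseteq> v}) \<le> real ((\<sigma> + 1) * card v ^ \<sigma>)"
    by (intro of_nat_mono) simp
  then show ?thesis using n by (simp add: powr_realpow distrib_right)
qed

text \<open>The exponents whose infimum is \<open>t_star\<close>, so that estimates can be made for
  one exponent before passing to the infimum.\<close>

definition growth_exponents :: "(nat set \<Rightarrow> real) \<Rightarrow> nat \<Rightarrow> real set" where
  "growth_exponents \<gamma> \<sigma> = {t. t \<ge> 0 \<and> (\<exists>C>0. \<forall>v. finite v \<longrightarrow>
      real (card {u \<in> wsets \<gamma> \<sigma>. u \<subseteq> v}) \<le> C * real (card v) powr t)}"

lemma t_star_eq: "t_star \<gamma> \<sigma> = Inf (ereal ` growth_exponents \<gamma> \<sigma>)"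
  unfolding t_star_def growth_exponents_def by (rule arg_cong[where f = Inf]) auto

lemma growth_exponents_nonempty: "real \<sigma> \<in> growth_exponents \<gamma> \<sigma>"
  unfolding growth_exponents_def
  by (intro CollectI conjI exI[of _ "real (\<sigma> + 1)"] allI impI card_subsets_le) auto

text \<open>With exponent \<open>0\<close> every \<open>v\<close> would contain at most
  \<open>C\<close> of the sets, but the union of more than \<open>C\<close> of them contains them
  all.\<close>

lemma growth_exponent_pos:
  assumes t: "t \<in> growth_exponents \<gamma> \<sigma>" and inf: "infinite (wsets \<gamma> \<sigma>)"
  shows "0 < t"
proof (rule ccontr)
  assume "\<not> 0 < t"
  with t obtain C where C: "0 < C" "\<And>v. finite v \<Longrightarrow>
      real (card {u \<in> wsets \<gamma> \<sigma>. u \<subseteq> v}) \<le> C * real (card v) powr 0"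
    by (auto simp: growth_exponents_def)
  obtain F where F: "finite F" "card F = nat \<lceil>C\<rceil> + 1" "F \<subseteq> wsets \<gamma> \<sigma>"
    using infinite_arbitrarily_large[OF inf] by blast
  have v: "finite (\<Union>F)" using F by (auto simp: wsets_def)
  have "card F \<le> card {u \<in> wsets \<gamma> \<sigma>. u \<subseteq> \<Union>F}"
    using F v by (intro card_mono) (auto intro: finite_subset[of _ "Pow (\<Union>F)"])
  then have "real (card F) \<le> C * real (card (\<Union>F)) powr 0" using C(2)[OF v] by linarith
  also have "\<dots> \<le> C" using C(1) by (simp add: powr_def)
  finally show False using F(2) by linarith
qed

section \<open>The ordered weights and the lower bound on their decay\<close>

context anchored_kernel
begin

lemma ghat_pos: "u \<in> wsets \<gamma> \<sigma> \<Longrightarrow> 0 < ghat u"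
  using C0_pos by (simp add: wsets_def gamma_hat_def)

text \<open>Too many weights of size \<open>\<delta>\<close> would exceed the finite total. This is
  what allows the weights to be listed in decreasing order.\<close>

lemma finite_ghat_ge:
  assumes "0 < \<delta>" shows "finite {w. finite w \<and> \<delta> \<le> ghat w}"
proof (rule ccontr)
  assume inf: "infinite {w. finite w \<and> \<delta> \<le> ghat w}"
  let ?S = "infsum ghat {u. finite u}"
  obtain F where F: "finite F" "card F = nat \<lceil>?S / \<delta>\<rceil> + 1" "F \<subseteq> {w. finite w \<and> \<delta> \<le> ghat w}"
    using infinite_arbitrarily_large[OF inf] by blast
  have "real (card F) * \<delta> \<le> (\<Sum>u\<in>F. ghat u)" using F by (intro sum_bounded_below) auto
  also have "\<dots> \<le> ?S"
    using F ghat_nonneg by (intro finite_sum_le_infsum ghat_summable) auto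
  finally have "real (card F) \<le> ?S / \<delta>" using assms by (simp add: field_simps)
  then show False using F(2) by linarith
qed

lemma wenum:
  assumes "infinite (wsets \<gamma> \<sigma>)"
  shows "bij_betw (wenum \<rho> k \<gamma> \<sigma>) UNIV (wsets \<gamma> \<sigma>)"
    and "i \<le> j \<Longrightarrow> ghat (wenum \<rho> k \<gamma> \<sigma> j) \<le> ghat (wenum \<rho> k \<gamma> \<sigma> i)"
proof -
  have "\<exists>e::nat \<Rightarrow> nat set. bij_betw e UNIV (wsets \<gamma> \<sigma>) \<and> (\<forall>i j. i \<le> j \<longrightarrow> ghat (e j) \<le> ghat (e i))"
  proof (rule ex_decreasing_enumeration)
    show "countable (wsets \<gamma> \<sigma>)"
      by (rule countable_subset[OF _ countable_Collect_finite]) (auto simp: wsets_def)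
    show "finite {w \<in> wsets \<gamma> \<sigma>. ghat u \<le> ghat w}" if "u \<in> wsets \<gamma> \<sigma>" for u
      by (rule finite_subset[OF _ finite_ghat_ge[OF ghat_pos[OF that]]]) (auto simp: wsets_def)
  qed (rule assms)
  from someI_ex[OF this] show "bij_betw (wenum \<rho> k \<gamma> \<sigma>) UNIV (wsets \<gamma> \<sigma>)"
    and "i \<le> j \<Longrightarrow> ghat (wenum \<rho> k \<gamma> \<sigma> j) \<le> ghat (wenum \<rho> k \<gamma> \<sigma> i)"
    unfolding wenum_def by blast+
qed

text \<open>At most half of the first \<open>j + 1\<close> sets lie in \<open>V\<close>; the other half has total weight at most \<open>2 \<epsilon>\<^sup>2\<close>.\<close>
lemma ghat_wenum_le:
  assumes inf: "infinite (wsets \<gamma> \<sigma>)" and V: "finite V"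
    and few: "2 * real (card {u \<in> wsets \<gamma> \<sigma>. u \<subseteq> V}) \<le> real (j + 1)"
    and tail: "\<And>F. finite F \<Longrightarrow> (\<forall>u\<in>F. finite u \<and> \<not> u \<subseteq> V) \<Longrightarrow> (\<Sum>u\<in>F. ghat u) \<le> 2 * \<epsilon>\<^sup>2"
  shows "ghat (wenum \<rho> k \<gamma> \<sigma> j) * real (j + 1) \<le> 4 * \<epsilon>\<^sup>2"
proof -
  let ?e = "wenum \<rho> k \<gamma> \<sigma>" and ?U = "{u \<in> wsets \<gamma> \<sigma>. u \<subseteq> V}"
  let ?F = "?e ` {..j} - ?U"
  have inj: "inj_on ?e {..j}" using wenum(1)[OF inf] by (auto simp: bij_betw_def inj_on_def)
  have eW: "?e i \<in> wsets \<gamma> \<sigma>" for i using wenum(1)[OF inf] by (auto simp: bij_betw_def)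
  have finU: "finite ?U" by (rule finite_subset[of _ "Pow V"]) (use V in auto)
  have "card (?e ` {..j}) - card ?U \<le> card ?F" by (rule diff_card_le_card_Diff[OF finU])
  then have "real (j + 1) / 2 \<le> real (card ?F)" using few by (simp add: card_image[OF inj])
  then have "real (j + 1) / 2 * ghat (?e j) \<le> real (card ?F) * ghat (?e j)"
    by (intro mult_right_mono less_imp_le[OF ghat_pos[OF eW]])
  also have "\<dots> \<le> (\<Sum>u\<in>?F. ghat u)"
    by (rule sum_bounded_below) (auto intro: wenum(2)[OF inf])
  also have "\<dots> \<le> 2 * \<epsilon>\<^sup>2"
  proof (rule tail)
    show "\<forall>u\<in>?F. finite u \<and> \<not> u \<subseteq> V" using eW by (auto simp: wsets_def)
  qed simp
  finally show ?thesis by (simp add: algebra_simps)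
qed

text \<open>At accuracy \<open>\<epsilon>\<close> the set \<open>V\<close> contains
  \<open>O(\<epsilon> powr (- (p * t / s)))\<close> of the weighted sets. Choosing
  \<open>\<epsilon>\<close> so that this is half of the first \<open>j + 1\<close> sets,
  \<open>ghat_wenum_le\<close> bounds the weight with index \<open>j\<close> by a multiple of
  \<open>\<epsilon>\<^sup>2 / (j + 1)\<close>.\<close>

lemma decay_ge:
  fixes W :: "'w itself"
  assumes s: "0 < s"
    and growth: "\<exists>c>0. \<forall>\<^sub>F \<nu> in sequentially. dollar \<nu> \<ge> ennreal (c * real \<nu> powr s)"
    and p: "0 < p" and C: "0 \<le> C"
    and comp: "\<And>\<epsilon>. 0 < \<epsilon> \<Longrightarrow> \<epsilon> \<le> 1 \<Longrightarrow> comp_nest W D k a \<rho> \<gamma> dollar \<epsilon> \<le> ennreal (C * \<epsilon> powr (-p))"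
    and inf: "infinite (wsets \<gamma> \<sigma>)" and t: "t \<in> growth_exponents \<gamma> \<sigma>"
  shows "ereal (1 + 2 * s / (p * t)) \<le> decay \<rho> k \<gamma> \<sigma>"
proof -
  let ?g = "\<lambda>j. ghat (wenum \<rho> k \<gamma> \<sigma> j)"
  have t_pos: "0 < t" by (rule growth_exponent_pos[OF t inf])
  from t obtain Ct where Ct: "0 < Ct" "\<And>v. finite v \<Longrightarrow>
      real (card {u \<in> wsets \<gamma> \<sigma>. u \<subseteq> v}) \<le> Ct * real (card v) powr t"
    by (auto simp: growth_exponents_def)
  obtain B where B: "0 < B"
    "\<And>N \<epsilon>. 1 \<le> N \<Longrightarrow> 0 < \<epsilon> \<Longrightarrow> comp_nest W D k a \<rho> \<gamma> dollar \<epsilon> < ennreal N \<Longrightarrow>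
    \<exists>V. finite V \<and> real (card V) \<le> B * N powr (1/s) \<and>
      (\<forall>F. finite F \<longrightarrow> (\<forall>u\<in>F. finite u \<and> \<not> u \<subseteq> V) \<longrightarrow> (\<Sum>u\<in>F. ghat u) \<le> 2 * \<epsilon>\<^sup>2)"
    by (rule comp_nest_tail_bound[OF s growth, where W = W]) blast
  \<comment> \<open>The constant that results from inserting
    \<open>N = (C + 1) * \<epsilon> powr (-p)\<close> into the size bound for \<open>V\<close> and
    that into the count with exponent \<open>t\<close>.\<close>
  define A where "A = Ct * (B * (C + 1) powr (1/s)) powr t"
  have A: "0 < A" using Ct(1) B(1) C by (simp add: A_def)
  have bound: "?g j * real (j + 1) \<le> 4 * \<epsilon>\<^sup>2"
    if eps: "0 < \<epsilon>" "\<epsilon> \<le> 1" and j: "2 * (A * \<epsilon> powr (- (p * t / s))) \<le> real (j + 1)" for \<epsilon> j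
  proof -
    \<comment> \<open>\<open>C + 1\<close> in place of \<open>C\<close> provides the strict
      inequality and ensures \<open>1 \<le> N\<close>.\<close>
    define N where "N = (C + 1) * \<epsilon> powr (-p)"
    have eps_p: "1 \<le> \<epsilon> powr (-p)" using eps p powr_mono2'[of "-p" \<epsilon> 1] by simp
    then have "1 * 1 \<le> N" unfolding N_def using C by (intro mult_mono) auto
    then have N: "1 \<le> N" by simp
    have "C * \<epsilon> powr (-p) < N" using eps(1) by (simp add: N_def distrib_right)
    then have "comp_nest W D k a \<rho> \<gamma> dollar \<epsilon> < ennreal N"
      using comp[OF eps] N C by (auto intro: le_less_trans simp: ennreal_less_iff)
    from B(2)[OF N eps(1) this] obtain V where V: "finite V" "real (card V) \<le> B * N powr (1/s)"
      "\<And>F. finite F \<Longrightarrow> (\<forall>u\<in>F. finite u \<and> \<not> u \<subseteq> V) \<Longrightarrow> (\<Sum>u\<in>F. ghat u) \<le> 2 * \<epsilon>\<^sup>2"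
      by blast
    have "real (card {u \<in> wsets \<gamma> \<sigma>. u \<subseteq> V}) \<le> Ct * real (card V) powr t" by (rule Ct(2)[OF V(1)])
    also have "\<dots> \<le> Ct * (B * N powr (1/s)) powr t"
      using Ct(1) V(2) t_pos by (intro mult_left_mono powr_mono2) auto
    also have "B * N powr (1/s) = (B * (C + 1) powr (1/s)) * \<epsilon> powr (- (p / s))"
      using C by (simp add: N_def powr_mult powr_powr)
    also have "Ct * \<dots> powr t = A * \<epsilon> powr (- (p * t / s))"
      using B(1) C by (simp add: A_def powr_mult powr_powr)
    finally show ?thesis
      using j by (intro ghat_wenum_le[OF inf V(1) _ V(3)]) auto
  qed
  define q where "q = 2 * s / (p * t)"
  define K where "K = 4 * (2 * A) powr q"
  have g_le: "?g j \<le> K * real (Suc j) powr (- (1 + q))" if j: "2 * A \<le> real (Suc j)" for j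
  proof -
    define y where "y = real (Suc j) / (2 * A)"
    \<comment> \<open>The solution of
      \<open>2 * A * \<epsilon> powr (- (p * t / s)) = real (Suc j)\<close>.\<close>
    define \<epsilon> where "\<epsilon> = y powr (- (s / (p * t)))"
    have y: "1 \<le> y" using j A by (simp add: y_def)
    have "\<epsilon> \<le> 1" unfolding \<epsilon>_def using y s p t_pos powr_mono[of "- (s / (p * t))" 0 y] by simp
    moreover have "0 < \<epsilon>" using y by (simp add: \<epsilon>_def)
    moreover have "\<epsilon> powr (- (p * t / s)) = y"
      using y s p t_pos by (simp add: \<epsilon>_def powr_powr)
    then have "2 * (A * \<epsilon> powr (- (p * t / s))) \<le> real (j + 1)" using A by (simp add: y_def)
    ultimately have "?g j * real (Suc j) \<le> 4 * \<epsilon>\<^sup>2" using bound by simp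
    also have "\<epsilon>\<^sup>2 = y powr (- q)"
      using y by (simp add: \<epsilon>_def q_def powr_powr mult.commute flip: powr_numeral)
    also have "4 * y powr (- q) = K * real (Suc j) powr (- q)"
      using A by (simp add: y_def K_def powr_divide powr_minus field_simps)
    finally have "?g j \<le> K * real (Suc j) powr (- q) / real (Suc j)"
      by (simp add: field_simps)
    also have "\<dots> = K * real (Suc j) powr (- (1 + q))"
      by (simp add: powr_diff powr_minus field_simps)
    finally show ?thesis .
  qed
  have lim: "(\<lambda>j. ?g j * real (Suc j) powr r) \<longlonglongrightarrow> 0" if r: "r < 1 + q" for r
  proof (rule tendsto_sandwich)
    show "\<forall>\<^sub>F j in sequentially. 0 \<le> ?g j * real (Suc j) powr r"
      using bij_betwE[OF wenum(1)[OF inf]]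
      by (intro always_eventually allI mult_nonneg_nonneg less_imp_le[OF ghat_pos]) auto
    have "\<forall>\<^sub>F j in sequentially. 2 * A \<le> real (Suc j)"
      by (rule eventually_sequentiallyI[of "nat \<lceil>2 * A\<rceil>"]) linarith
    then show "\<forall>\<^sub>F j in sequentially. ?g j * real (Suc j) powr r \<le> K * real (Suc j) powr (r - (1 + q))"
    proof eventually_elim
      case (elim j)
      have "?g j * real (Suc j) powr r \<le> K * real (Suc j) powr (- (1 + q)) * real (Suc j) powr r"
        by (intro mult_right_mono g_le[OF elim]) auto
      also have "\<dots> = K * real (Suc j) powr (r - (1 + q))"
        by (simp add: mult.assoc flip: powr_add) (simp add: algebra_simps)
      finally show ?case .
    qed
    have "((\<lambda>x. x powr (r - (1 + q))) \<longlongrightarrow> 0) at_top" using r by (intro tendsto_neg_powr filterlim_ident) auto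
    then have "(\<lambda>j. real (Suc j) powr (r - (1 + q))) \<longlonglongrightarrow> 0"
      by (rule filterlim_compose)
        (rule filterlim_compose[OF filterlim_real_sequentially filterlim_Suc])
    then show "(\<lambda>j. K * real (Suc j) powr (r - (1 + q))) \<longlonglongrightarrow> 0"
      using tendsto_mult_right_zero by blast
  qed simp
  \<comment> \<open>Convergence is available only for exponents strictly below \<open>1 + q\<close>;
    density of the order closes the gap.\<close>
  have "ereal (1 + q) \<le> Sup {ereal p | p. (\<lambda>j. ?g j * real (Suc j) powr p) \<longlonglongrightarrow> 0}"
  proof (rule dense_le)
    fix z assume z: "z < ereal (1 + q)"
    show "z \<le> Sup {ereal p | p. (\<lambda>j. ?g j * real (Suc j) powr p) \<longlonglongrightarrow> 0}"
    proof (cases z)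
      case (real r)
      then show ?thesis using z lim by (intro Sup_upper) auto
    qed (use z in auto)
  qed
  then show ?thesis using inf by (simp add: decay_def q_def)
qed

lemma decay_gt_1:
  fixes W :: "'w itself"
  assumes s: "0 < s"
    and growth: "\<exists>c>0. \<forall>\<^sub>F \<nu> in sequentially. dollar \<nu> \<ge> ennreal (c * real \<nu> powr s)"
    and p: "0 < p" and C: "0 \<le> C"
    and comp: "\<And>\<epsilon>. 0 < \<epsilon> \<Longrightarrow> \<epsilon> \<le> 1 \<Longrightarrow> comp_nest W D k a \<rho> \<gamma> dollar \<epsilon> \<le> ennreal (C * \<epsilon> powr (-p))"
  shows "1 < decay \<rho> k \<gamma> \<sigma>"
proof (cases "finite (wsets \<gamma> \<sigma>)")
  case True then show ?thesis by (simp add: decay_def)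
next
  case False
  have "0 < real \<sigma>" by (rule growth_exponent_pos[OF growth_exponents_nonempty False])
  then have "ereal 1 < ereal (1 + 2 * s / (p * real \<sigma>))" using s p by simp
  also have "\<dots> \<le> decay \<rho> k \<gamma> \<sigma>"
    by (rule decay_ge[OF s growth p C comp False growth_exponents_nonempty])
  finally show ?thesis by (simp add: one_ereal_def)
qed

text \<open>Solving \<open>decay_ge\<close> for \<open>t\<close> shows that every growth exponent is
  at least \<open>r\<close>. So \<open>t_star\<close> is at least \<open>r\<close>, and
  \<open>r\<close> is the value for which the term equals \<open>p\<close>.\<close>

lemma lb_term_le:
  fixes W :: "'w itself"
  assumes s: "0 < s"
    and growth: "\<exists>c>0. \<forall>\<^sub>F \<nu> in sequentially. dollar \<nu> \<ge> ennreal (c * real \<nu> powr s)"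
    and p: "0 < p" and C: "0 \<le> C"
    and comp: "\<And>\<epsilon>. 0 < \<epsilon> \<Longrightarrow> \<epsilon> \<le> 1 \<Longrightarrow> comp_nest W D k a \<rho> \<gamma> dollar \<epsilon> \<le> ennreal (C * \<epsilon> powr (-p))"
  shows "lb_term \<rho> k \<gamma> s \<sigma> \<le> ereal p"
proof (cases "decay \<rho> k \<gamma> \<sigma> = \<infinity>")
  case True then show ?thesis using p by (simp add: lb_term_def)
next
  case False
  then have inf: "infinite (wsets \<gamma> \<sigma>)" by (auto simp: decay_def)
  have "1 < decay \<rho> k \<gamma> \<sigma>" by (rule decay_gt_1[OF s growth p C comp])
  with False obtain d where d: "decay \<rho> k \<gamma> \<sigma> = ereal d" "1 < d"
    by (cases "decay \<rho> k \<gamma> \<sigma>") auto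
  define r where "r = 2 * s / (p * (d - 1))"
  have r: "0 < r" using s p d(2) by (simp add: r_def)
  have "ereal r \<le> t_star \<gamma> \<sigma>"
    unfolding t_star_eq
  proof (rule Inf_greatest, clarify)
    fix t assume t: "t \<in> growth_exponents \<gamma> \<sigma>"
    have t_pos: "0 < t" by (rule growth_exponent_pos[OF t inf])
    have "ereal (1 + 2 * s / (p * t)) \<le> ereal d"
      unfolding d(1)[symmetric] by (rule decay_ge[OF s growth p C comp inf t])
    then show "ereal r \<le> ereal t" using t_pos p d(2) by (simp add: r_def field_simps)
  qed
  then show ?thesis
  proof (cases "t_star \<gamma> \<sigma>")
    case (real \<tau>)
    with \<open>ereal r \<le> t_star \<gamma> \<sigma>\<close> have "r \<le> \<tau>" by simp
    then have "2 * s / \<tau> / (d - 1) \<le> 2 * s / r / (d - 1)"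
      using s r d(2) by (intro divide_right_mono divide_left_mono) auto
    also have "\<dots> = p" using s p d(2) by (simp add: r_def)
    finally show ?thesis using real r \<open>r \<le> \<tau>\<close> False d by (simp add: lb_term_def one_ereal_def)
  next
    case PInf
    then show ?thesis using False d p by (simp add: lb_term_def one_ereal_def)
  qed auto
qed

end

section \<open>Reduction to univariate integration\<close>

text \<open>For finite \<open>T\<close> and \<open>1 \<le> d\<close>, the largest number of
  evaluations of price \<open>d\<close> that the budget \<open>T\<close> covers.\<close>

definition pad :: "ennreal \<Rightarrow> ennreal \<Rightarrow> nat" where
  "pad d T = nat \<lfloor>enn2real (T / d)\<rfloor>"

lemma
  assumes d: "1 \<le> d" and T: "T \<noteq> top"
  shows of_nat_pad_mult_le: "of_nat (pad d T) * d \<le> T"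
    and le_pad: "of_nat n * d \<le> T \<Longrightarrow> n \<le> pad d T"
proof -
  show "of_nat (pad d T) * d \<le> T"
  proof (cases d)
    case (real r)
    then have r: "1 \<le> r" using d by simp
    obtain t where t: "T = ennreal t" "0 \<le> t" using T by (cases T) auto
    have "real (pad d T) \<le> t / r" using r t real by (simp add: pad_def divide_ennreal)
    then have "real (pad d T) * r \<le> t" using r by (simp add: field_simps)
    then show ?thesis using real r t by (simp add: ennreal_mult[symmetric] ennreal_of_nat_eq_real_of_nat ennreal_leI)
  qed (use T in \<open>simp add: pad_def\<close>)
  show "n \<le> pad d T" if le: "of_nat n * d \<le> T"
  proof (cases d)
    case (real r)
    then have r: "1 \<le> r" using d by simp
    obtain t where t: "T = ennreal t" "0 \<le> t" using T by (cases T) auto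
    have "real n * r \<le> t"
      using le real r t by (simp add: ennreal_mult[symmetric] ennreal_of_nat_eq_real_of_nat ennreal_le_iff)
    then have "real n \<le> t / r" using r by (simp add: field_simps)
    then show ?thesis using r t real by (simp add: pad_def divide_ennreal le_nat_floor)
  next
    case top
    have "n = 0"
    proof (rule ccontr)
      assume "n \<noteq> 0"
      then show False using le T top by (simp add: ennreal_mult_top top_unique)
    qed
    then show ?thesis by simp
  qed
qed

text \<open>Evaluated on a history that may run past the stopping time of \<open>A\<close>; it
  recovers that time from the values alone, so that the padded run can refer to it.\<close>

definition prefix_len :: "'p alg \<Rightarrow> real list \<Rightarrow> nat" where
  "prefix_len A h = (LEAST i. fst (snd A) (take i h))"

definition prefix_cost :: "('p \<Rightarrow> ennreal) \<Rightarrow> 'p alg \<Rightarrow> real list \<Rightarrow> ennreal" where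
  "prefix_cost c A h = (\<Sum>i<prefix_len A h. c (fst A (take i h)))"

text \<open>A run of \<open>A\<close> with its evaluation points mapped by \<open>h\<close>, continued beyond the stopping time of
  \<open>A\<close> until the number of evaluations is a function of the cost of the run of \<open>A\<close>. Without this
  padding the number of evaluations of a randomized algorithm need not be a random variable:
  only its cost is assumed to be measurable.\<close>
definition padded_alg :: "('p \<Rightarrow> ennreal) \<Rightarrow> ennreal \<Rightarrow> ('p \<Rightarrow> 'q) \<Rightarrow> 'p alg \<Rightarrow> 'q alg" where
  "padded_alg c d h A =
    (\<lambda>l. h (fst A l),
     \<lambda>l. (\<exists>i\<le>length l. fst (snd A) (take i l)) \<and> prefix_cost c A l \<noteq> top \<and> pad d (prefix_cost c A l) \<le> length l,
     \<lambda>l. snd (snd A) (take (prefix_len A l) l))"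

lemma length_alg_vals: "length (alg_vals A f n) = n"
  by (induction n) auto

lemma take_alg_vals: "i \<le> n \<Longrightarrow> take i (alg_vals A f n) = alg_vals A f i"
  by (induction n) (auto simp: length_alg_vals le_Suc_eq)

text \<open>Every evaluation of \<open>A\<close> costs at least \<open>d\<close>, so
  \<open>A\<close> stops within \<open>pad d\<close> of its cost, and the padded run contains the
  whole run of \<open>A\<close>. If that cost is infinite, the padded run never stops and its output
  is the default \<open>0\<close>.\<close>

lemma padded_alg:
  assumes f: "\<And>x. f x = g (h x)" and c: "\<And>x. d \<le> c x" and d: "1 \<le> d"
  shows alg_cost_padded: "alg_cost (\<lambda>_. d) (padded_alg c d h A) g =
      (if alg_cost c A f = top then top else of_nat (pad d (alg_cost c A f)) * d)"
    and alg_out_padded: "alg_out (padded_alg c d h A) g =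
      (if alg_cost c A f = top then 0 else alg_out A f)"
proof -
  let ?P = "padded_alg c d h A" and ?n = "alg_nevals A f" and ?T = "alg_cost c A f"
  have vals: "alg_vals ?P g m = alg_vals A f m" for m
    by (induction m) (auto simp: padded_alg_def f)
  have stop_iff: "(\<exists>i\<le>m. fst (snd A) (alg_vals A f i)) \<longleftrightarrow> alg_stops A f \<and> ?n \<le> m" for m
  proof
    assume "\<exists>i\<le>m. fst (snd A) (alg_vals A f i)"
    then obtain i where "i \<le> m" "fst (snd A) (alg_vals A f i)" by blast
    then show "alg_stops A f \<and> ?n \<le> m"
      using Least_le[of "\<lambda>n. fst (snd A) (alg_vals A f n)" i] by (auto simp: alg_stops_def alg_nevals_def)
  next
    assume "alg_stops A f \<and> ?n \<le> m"
    then show "\<exists>i\<le>m. fst (snd A) (alg_vals A f i)"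
      using LeastI_ex[of "\<lambda>n. fst (snd A) (alg_vals A f n)"]
      unfolding alg_stops_def alg_nevals_def by blast
  qed
  have len: "prefix_len A (alg_vals A f m) = ?n" if "alg_stops A f" "?n \<le> m" for m
    unfolding prefix_len_def
  proof (rule Least_equality)
    show "fst (snd A) (take ?n (alg_vals A f m))"
      using that LeastI_ex[of "\<lambda>n. fst (snd A) (alg_vals A f n)"]
      by (simp add: take_alg_vals) (simp add: alg_stops_def alg_nevals_def)
    fix i assume i: "fst (snd A) (take i (alg_vals A f m))"
    show "?n \<le> i"
    proof (cases "i \<le> m")
      case True
      then show ?thesis using i unfolding alg_nevals_def by (simp add: take_alg_vals Least_le)
    qed (use that in simp)
  qed
  have cost: "prefix_cost c A (alg_vals A f m) = ?T" if "alg_stops A f" "?n \<le> m" for m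
    using that by (simp add: prefix_cost_def len take_alg_vals alg_cost_def)
  have stop_P: "fst (snd ?P) (alg_vals ?P g m) \<longleftrightarrow>
      alg_stops A f \<and> ?n \<le> m \<and> ?T \<noteq> top \<and> pad d ?T \<le> m" for m
  proof -
    have "(\<exists>i\<le>m. fst (snd A) (take i (alg_vals A f m))) \<longleftrightarrow> alg_stops A f \<and> ?n \<le> m"
      unfolding stop_iff[symmetric] by (auto simp: take_alg_vals)
    then show ?thesis
      using cost[of m] by (auto simp: padded_alg_def[of c d h A] vals[unfolded padded_alg_def] length_alg_vals)
  qed
  have "alg_cost (\<lambda>_. d) ?P g = (if ?T = top then top else of_nat (pad d ?T) * d) \<and>
    alg_out ?P g = (if ?T = top then 0 else alg_out A f)"
  proof (cases "?T = top")
    case True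
    then have "\<not> alg_stops ?P g" unfolding alg_stops_def stop_P by simp
    then show ?thesis using True by (simp add: alg_cost_def alg_out_def)
  next
    case False
    then have stops: "alg_stops A f" by (auto simp: alg_cost_def split: if_splits)
    have "of_nat ?n * d = (\<Sum>i<?n. d)" by simp
    also have "\<dots> \<le> ?T" using stops by (simp add: alg_cost_def sum_mono c del: sum_constant)
    finally have n_le: "?n \<le> pad d ?T" by (rule le_pad[OF d False])
    have stop_P': "fst (snd ?P) (alg_vals ?P g m) \<longleftrightarrow> pad d ?T \<le> m" for m
      unfolding stop_P using stops False n_le by auto
    have stops_P: "alg_stops ?P g" unfolding alg_stops_def stop_P' by auto
    have n_P: "alg_nevals ?P g = pad d ?T"
      unfolding alg_nevals_def stop_P' by (rule Least_equality) auto
    have "alg_out ?P g = alg_out A f"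
      using stops stops_P n_le len[OF stops n_le]
      by (simp add: alg_out_def n_P vals) (simp add: padded_alg_def take_alg_vals)
    then show ?thesis using False stops_P by (simp add: alg_cost_def[of "\<lambda>_. d"] n_P)
  qed
  then show "alg_cost (\<lambda>_. d) ?P g = (if ?T = top then top else of_nat (pad d ?T) * d)"
    and "alg_out ?P g = (if ?T = top then 0 else alg_out A f)" by auto
qed

lemma wc_error_leI:
  assumes "\<And>f. f \<in> F \<Longrightarrow> (\<integral>\<^sup>+ \<omega>. ennreal ((I f - alg_out (Q \<omega>) f)\<^sup>2) \<partial>\<Omega>) \<le> ennreal (\<epsilon>\<^sup>2)"
    and eps: "0 \<le> \<epsilon>"
  shows "wc_error I \<Omega> Q F \<le> ennreal \<epsilon>"
proof -
  have le: "err_sq I \<Omega> Q F \<le> ennreal (\<epsilon>\<^sup>2)" unfolding err_sq_def using assms(1) by (rule SUP_least)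
  then have "err_sq I \<Omega> Q F \<noteq> top" by (auto simp: top_unique)
  moreover have "enn2real (err_sq I \<Omega> Q F) \<le> \<epsilon>\<^sup>2"
    using enn2real_mono[OF le] by simp
  then have "sqrt (enn2real (err_sq I \<Omega> Q F)) \<le> \<epsilon>" using eps by (intro real_le_lsqrt) auto
  ultimately show ?thesis by (simp add: wc_error_def ennreal_leI)
qed

lemma c_nest_ge:
  assumes v: "nested_seq v" and mono: "mono dollar"
  shows "dollar 1 \<le> c_nest dollar D a v x"
  unfolding c_nest_def
proof (rule INF_greatest)
  fix i
  have "1 \<le> card (v i)" using v by (simp add: nested_seq_def Suc_le_eq card_gt_0_iff)
  then show "dollar 1 \<le> dollar (card (v i))" by (rule monoD[OF mono])
qed

section \<open>Lifting univariate functions to infinitely many coordinates\<close>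

context anchored_kernel
begin

definition uni_lift :: "(real \<Rightarrow> real) \<Rightarrow> (nat \<Rightarrow> real) \<Rightarrow> real" where
  "uni_lift g x = (if x \<in> X then g (x 0) else 0)"

text \<open>A lift is \<open>0\<close> off \<open>X\<close>, and this is also the value of a
  function of the univariate space at the anchor. So each evaluation of a lift is one evaluation of
  \<open>g\<close>.\<close>

definition uni_point :: "(nat \<Rightarrow> real) \<Rightarrow> real" where
  "uni_point x = (if x \<in> X then x 0 else a)"

abbreviation uni_kernel :: "real \<Rightarrow> real \<Rightarrow> real" where
  "uni_kernel \<equiv> \<lambda>x y. \<gamma> {0} * k x y"

lemma pd_kernel_uni: "pd_kernel D uni_kernel"
  using gamma_nonneg by (intro pd_kernel_scale k_kernel) auto

lemma uni_lift_eq: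
  assumes "g \<in> rkhs D uni_kernel"
  shows "uni_lift g x = g (uni_point x)"
  using rkhs_eq_zero[OF assms anchor(1)] anchor(2) by (simp add: uni_lift_def uni_point_def)

lemma quad_form_uni_le:
  assumes xs: "\<And>i. i < n \<Longrightarrow> xs i \<in> X"
  shows "quad_form uni_kernel n c (\<lambda>i. xs i 0) \<le> quad_form (Kgamma \<gamma> k) n c xs"
proof -
  have "quad_form uni_kernel n c (\<lambda>i. xs i 0) = \<gamma> {0} * quad_form (kprod k {0}) n c xs"
    unfolding quad_form_scale by (simp add: quad_form_def kprod_def)
  then show ?thesis using quad_form_Kgamma_ge[of "{{0}}" n xs c] xs by simp
qed

lemma uni_lift_sum:
  "(\<And>i. i < n \<Longrightarrow> xs i \<in> X) \<Longrightarrow> (\<Sum>i<n. c i * uni_lift g (xs i)) = (\<Sum>i<n. c i * g (xs i 0))"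
  by (simp add: uni_lift_def)

lemma uni_lift_in_Bgamma:
  assumes g: "g \<in> rkhs_ball D uni_kernel"
  shows "uni_lift g \<in> Bgamma D \<gamma> k"
  unfolding Bgamma_def rkhs_ball_iff
proof (intro conjI allI impI)
  fix n and xs :: "nat \<Rightarrow> nat \<Rightarrow> real" and c :: "nat \<Rightarrow> real"
  assume "\<forall>i<n. xs i \<in> X"
  then have xs: "\<And>i. i < n \<Longrightarrow> xs i \<in> X" by blast
  have "(\<Sum>i<n. c i * g (xs i 0))\<^sup>2 \<le> quad_form uni_kernel n c (\<lambda>i. xs i 0)"
    using g XD[OF xs] by (simp add: rkhs_ball_iff)
  also have "\<dots> \<le> quad_form (Kgamma \<gamma> k) n c xs" by (rule quad_form_uni_le[OF xs])
  finally show "(\<Sum>i<n. c i * uni_lift g (xs i))\<^sup>2 \<le> quad_form (Kgamma \<gamma> k) n c xs"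
    by (simp only: uni_lift_sum[OF xs])
qed (simp add: uni_lift_def)

lemma uni_lift_in_Hgamma:
  assumes g: "g \<in> rkhs D uni_kernel"
  shows "uni_lift g \<in> Hgamma D \<gamma> k"
proof -
  from g obtain C where C: "\<And>n xs c. (\<forall>i<n. xs i \<in> D) \<Longrightarrow>
      (\<Sum>i<n. c i * g (xs i))\<^sup>2 \<le> C * quad_form uni_kernel n c xs"
    unfolding rkhs_iff by blast
  \<comment> \<open>\<open>max C 0\<close> is nonnegative, so the comparison of the two forms may be
    multiplied by it.\<close>
  have *: "(\<Sum>i<n. c i * uni_lift g (xs i))\<^sup>2 \<le> max C 0 * quad_form (Kgamma \<gamma> k) n c xs"
    if "\<forall>i<n. xs i \<in> X" for n c and xs :: "nat \<Rightarrow> nat \<Rightarrow> real"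
  proof -
    have xs: "\<And>i. i < n \<Longrightarrow> xs i \<in> X" using that by blast
    have "(\<Sum>i<n. c i * g (xs i 0))\<^sup>2 \<le> C * quad_form uni_kernel n c (\<lambda>i. xs i 0)"
      using XD[OF xs] by (intro C) auto
    also have "\<dots> \<le> max C 0 * quad_form uni_kernel n c (\<lambda>i. xs i 0)"
      using XD[OF xs] by (intro mult_right_mono pd_kernelD[OF pd_kernel_uni]) auto
    also have "\<dots> \<le> max C 0 * quad_form (Kgamma \<gamma> k) n c xs"
      by (intro mult_left_mono quad_form_uni_le[OF xs]) auto
    finally show ?thesis by (simp only: uni_lift_sum[OF xs])
  qed
  show ?thesis
    unfolding Hgamma_def rkhs_iff
    by (intro conjI exI[of _ "max C 0"] allI impI *) (simp_all add: uni_lift_def)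
qed

text \<open>Every set other than \<open>{}\<close> and \<open>{0}\<close> has an anchored
  coordinate, so its diagonal term is \<open>0\<close> and the sum is finite.\<close>

lemma anchored_point_in_X:
  assumes "t \<in> D" shows "(\<lambda>j. if j = 0 then t else a) \<in> X"
proof -
  let ?x = "\<lambda>j::nat. if j = 0 then t else a"
  have zero: "kprod k u ?x ?x = 0" if u: "u \<in> {u. finite u} - {{}, {0}}" for u
  proof -
    from u obtain j where "j \<in> u" "j \<noteq> 0" by auto
    then show ?thesis unfolding kprod_def using u anchor(2) by (intro prod_zero) auto
  qed
  have "((\<lambda>u. \<gamma> u * kprod k u ?x ?x) has_sum (\<Sum>u\<in>{{}, {0}}. \<gamma> u * kprod k u ?x ?x)) {u. finite u}"
    by (rule has_sum_finite_neutralI[OF _ _ _ refl]) (use zero in auto)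
  then show ?thesis using assms anchor(1) by (auto simp: Xdom_def summable_on_def)
qed

text \<open>If \<open>g\<close> is not measurable, then neither is its lift, because \<open>g\<close> is recovered on the section of
  points that differ from the anchor in the first coordinate only; both integrals are then \<open>0\<close>.\<close>
lemma Iint_uni_lift: "Iint \<rho> (uni_lift g) = (\<integral>x. g x \<partial>\<rho>)"
proof (cases "g \<in> borel_measurable \<rho>")
  case True
  note [measurable] = True X_measurable
  have lift: "uni_lift g = (\<lambda>x. if x \<in> X then g (x 0) else 0)" by (auto simp: uni_lift_def)
  have "Iint \<rho> (uni_lift g) = (\<integral>x. g (x 0) \<partial>PX)"
    unfolding Iint_def
  proof (rule integral_cong_AE)
    show "uni_lift g \<in> borel_measurable PX" unfolding lift by measurable
    show "AE x in PX. uni_lift g x = g (x 0)" using AE_X by eventually_elim (simp add: uni_lift_def)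
  qed measurable
  also have "\<dots> = (\<integral>t. g t \<partial>distr PX \<rho> (\<lambda>x. x 0))"
    by (rule integral_distr[symmetric]) (use True in measurable)
  also have "distr PX \<rho> (\<lambda>x. x 0) = \<rho>" by (rule PX.PiM_component) simp
  finally show ?thesis .
next
  case False
  have "uni_lift g \<notin> borel_measurable PX"
  proof
    assume lift: "uni_lift g \<in> borel_measurable PX"
    have "(\<lambda>t j. if j = (0::nat) then t else a) \<in> \<rho> \<rightarrow>\<^sub>M PX"
      by (rule measurable_PiM_single') (auto simp: space_rho anchor(1))
    from measurable_compose[OF this lift]
    have "(\<lambda>t. uni_lift g (\<lambda>j. if j = 0 then t else a)) \<in> borel_measurable \<rho>" .
    then have "g \<in> borel_measurable \<rho>"
      by (rule measurable_cong[THEN iffD1, rotated]) (simp add: uni_lift_def anchored_point_in_X space_rho)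
    with False show False by simp
  qed
  then have "\<not> integrable PX (uni_lift g)" by blast
  moreover have "\<not> integrable \<rho> g" using False by blast
  ultimately show ?thesis by (simp add: Iint_def not_integrable_integral_eq)
qed

text \<open>The univariate algorithm is the padded run of the given algorithm on lifts. Its cost is
  at most that of the original run, and its output agrees almost surely for functions in the
  ball.\<close>

lemma min_err_uni_le:
  fixes W :: "'w itself"
  assumes mono: "mono dollar" and ge1: "1 \<le> dollar 1" and eps: "0 \<le> \<epsilon>"
    and comp: "comp_nest W D k a \<rho> \<gamma> dollar \<epsilon> < ennreal N" and N: "N \<le> real n"
  shows "min_err_uni W D k \<rho> \<gamma> dollar n \<le> ennreal \<epsilon>"
proof -
  from comp obtain \<Omega> :: "'w measure" and Q v where
    alg: "ran_alg \<Omega> Q (Hgamma D \<gamma> k) {c_nest dollar D a v | v. nested_seq v}"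
    and err: "wc_error (Iint \<rho>) \<Omega> Q (Bgamma D \<gamma> k) \<le> ennreal \<epsilon>"
    and v: "nested_seq v"
    and cost: "exp_cost (c_nest dollar D a v) \<Omega> Q (Bgamma D \<gamma> k) < ennreal N"
    unfolding comp_nest_def cost_nest_def by (auto simp: INF_less_iff)
  let ?c = "c_nest dollar D a v"
  define d where "d = dollar 1"
  note d = ge1[folded d_def]
  define P where "P \<omega> = padded_alg ?c d uni_point (Q \<omega>)" for \<omega>
  let ?H = "rkhs D uni_kernel" and ?B = "rkhs_ball D uni_kernel"
  let ?T = "\<lambda>g \<omega>. alg_cost ?c (Q \<omega>) (uni_lift g)"
  interpret \<Omega>: prob_space \<Omega> using alg by (simp add: ran_alg_def)
  have cost_P: "alg_cost (\<lambda>_. d) (P \<omega>) g = (if ?T g \<omega> = top then top else of_nat (pad d (?T g \<omega>)) * d)"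
    if "g \<in> ?H" for \<omega> g
    unfolding P_def by (rule alg_cost_padded[where f = "uni_lift g" and g = g and h = uni_point, OF uni_lift_eq[OF that] c_nest_ge[OF v mono, folded d_def] d])
  have out_P: "alg_out (P \<omega>) g = (if ?T g \<omega> = top then 0 else alg_out (Q \<omega>) (uni_lift g))"
    if "g \<in> ?H" for \<omega> g
    unfolding P_def by (rule alg_out_padded[where f = "uni_lift g" and g = g and h = uni_point, OF uni_lift_eq[OF that] c_nest_ge[OF v mono, folded d_def] d])
  have T [measurable]: "?T g \<in> borel_measurable \<Omega>"
    and out [measurable]: "(\<lambda>\<omega>. alg_out (Q \<omega>) (uni_lift g)) \<in> borel_measurable \<Omega>"
    and out_int: "integrable \<Omega> (\<lambda>\<omega>. (alg_out (Q \<omega>) (uni_lift g))\<^sup>2)" if "g \<in> ?H" for g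
    using alg v uni_lift_in_Hgamma[OF that] by (auto simp: ran_alg_def)
  have ran: "ran_alg \<Omega> P ?H {\<lambda>_. d}"
    unfolding ran_alg_def
  proof (intro conjI ballI \<Omega>.prob_space_axioms)
    fix g assume g: "g \<in> ?H"
    note [measurable] = T[OF g] out[OF g]
    show out_meas: "(\<lambda>\<omega>. alg_out (P \<omega>) g) \<in> borel_measurable \<Omega>"
      unfolding out_P[OF g] by measurable
    show "integrable \<Omega> (\<lambda>\<omega>. (alg_out (P \<omega>) g)\<^sup>2)"
      by (rule Bochner_Integration.integrable_bound[OF out_int[OF g]])
        (use out_meas in \<open>auto simp: out_P[OF g]\<close>)
    have [measurable]: "(\<lambda>T. pad d T) \<in> borel \<rightarrow>\<^sub>M count_space UNIV"
      unfolding pad_def by measurable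
    show "(\<lambda>\<omega>. alg_cost c (P \<omega>) g) \<in> borel_measurable \<Omega>" if "c \<in> {\<lambda>_. d}" for c
      unfolding singletonD[OF that] cost_P[OF g] by measurable
  qed
  have T_le: "(\<integral>\<^sup>+\<omega>. ?T g \<omega> \<partial>\<Omega>) \<le> ennreal N" if g: "g \<in> ?B" for g
  proof -
    have "(\<integral>\<^sup>+\<omega>. ?T g \<omega> \<partial>\<Omega>) \<le> exp_cost ?c \<Omega> Q (Bgamma D \<gamma> k)"
      unfolding exp_cost_def by (rule SUP_upper[OF uni_lift_in_Bgamma[OF g]])
    then show ?thesis using cost by simp
  qed
  have B_H: "g \<in> ?H" if "g \<in> ?B" for g using that rkhs_ball_subset_rkhs by blast
  have exp: "exp_cost (\<lambda>_. d) \<Omega> P ?B \<le> of_nat n"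
    unfolding exp_cost_def
  proof (rule SUP_least)
    fix g assume g: "g \<in> ?B"
    have "(\<integral>\<^sup>+\<omega>. alg_cost (\<lambda>_. d) (P \<omega>) g \<partial>\<Omega>) \<le> (\<integral>\<^sup>+\<omega>. ?T g \<omega> \<partial>\<Omega>)"
      using of_nat_pad_mult_le[OF d] by (intro nn_integral_mono) (simp add: cost_P[OF B_H[OF g]])
    also have "\<dots> \<le> ennreal N" by (rule T_le[OF g])
    also have "\<dots> \<le> of_nat n" using N by (simp add: ennreal_of_nat_eq_real_of_nat ennreal_leI)
    finally show "(\<integral>\<^sup>+\<omega>. alg_cost (\<lambda>_. d) (P \<omega>) g \<partial>\<Omega>) \<le> of_nat n" .
  qed
  have "wc_error (\<lambda>g. \<integral>x. g x \<partial>\<rho>) \<Omega> P ?B \<le> ennreal \<epsilon>"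
  proof (rule wc_error_leI[OF _ eps])
    fix g assume g: "g \<in> ?B"
    \<comment> \<open>The outputs can differ only where the cost is infinite, a null event because
      the expected cost is finite.\<close>
    have "(\<integral>\<^sup>+\<omega>. ?T g \<omega> \<partial>\<Omega>) \<noteq> \<infinity>" using T_le[OF g] by (auto simp: top_unique)
    then have "AE \<omega> in \<Omega>. ?T g \<omega> \<noteq> \<infinity>"
      by (rule nn_integral_noteq_infinite[OF T[OF B_H[OF g]]])
    then have "AE \<omega> in \<Omega>. ennreal (((\<integral>x. g x \<partial>\<rho>) - alg_out (P \<omega>) g)\<^sup>2) =
        ennreal ((Iint \<rho> (uni_lift g) - alg_out (Q \<omega>) (uni_lift g))\<^sup>2)"
      by eventually_elim (simp add: out_P[OF B_H[OF g]] Iint_uni_lift)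
    then have "(\<integral>\<^sup>+ \<omega>. ennreal (((\<integral>x. g x \<partial>\<rho>) - alg_out (P \<omega>) g)\<^sup>2) \<partial>\<Omega>) =
        (\<integral>\<^sup>+ \<omega>. ennreal ((Iint \<rho> (uni_lift g) - alg_out (Q \<omega>) (uni_lift g))\<^sup>2) \<partial>\<Omega>)"
      by (rule nn_integral_cong_AE)
    also have "\<dots> \<le> ennreal (\<epsilon>\<^sup>2)" by (rule err_sq_le[OF err eps uni_lift_in_Bgamma[OF g]])
    finally show "(\<integral>\<^sup>+ \<omega>. ennreal (((\<integral>x. g x \<partial>\<rho>) - alg_out (P \<omega>) g)\<^sup>2) \<partial>\<Omega>) \<le> ennreal (\<epsilon>\<^sup>2)" .
  qed
  then show ?thesis
    unfolding min_err_uni_def d_def[symmetric] by (intro INF_lower2[of "(\<Omega>, P)"]) (use ran exp in auto)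
qed

text \<open>A budget of order \<open>x powr p\<close> achieves error \<open>1 / x\<close>, while the
  univariate bound forces an error of order \<open>x powr (- (p * \<alpha> / 2))\<close>. For
  \<open>p < 2 / \<alpha>\<close> these conflict as \<open>x\<close> grows.\<close>

lemma univariate_exponent_le:
  fixes W :: "'w itself"
  assumes mono: "mono dollar" and ge1: "1 \<le> dollar 1" and \<alpha>: "0 < \<alpha>"
    and lb: "\<exists>c>0. \<forall>\<^sub>F N in sequentially. min_err_uni W D k \<rho> \<gamma> dollar N \<ge> ennreal (c * real N powr (- \<alpha> / 2))"
    and p: "0 < p" and C: "0 \<le> C"
    and comp: "\<And>\<epsilon>. 0 < \<epsilon> \<Longrightarrow> \<epsilon> \<le> 1 \<Longrightarrow> comp_nest W D k a \<rho> \<gamma> dollar \<epsilon> \<le> ennreal (C * \<epsilon> powr (-p))"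
  shows "2 / \<alpha> \<le> p"
proof (rule ccontr)
  assume "\<not> 2 / \<alpha> \<le> p"
  then have neg: "p * \<alpha> / 2 - 1 < 0" using \<alpha> by (simp add: field_simps)
  from lb obtain c n\<^sub>0 where c: "0 < c" and n\<^sub>0: "\<And>n. n\<^sub>0 \<le> n \<Longrightarrow>
      ennreal (c * real n powr (- \<alpha> / 2)) \<le> min_err_uni W D k \<rho> \<gamma> dollar n"
    unfolding eventually_sequentially by blast
  define c' where "c' = c * (2 * (C + 1)) powr (- \<alpha> / 2)"
  \<comment> \<open>\<open>x\<close> plays the role of \<open>1 / \<epsilon>\<close>; the second
    condition makes the budget \<open>n\<close> at least \<open>n\<^sub>0\<close>. Rounding up at
    most doubles \<open>N\<close>, hence the factor \<open>2\<close> in \<open>c'\<close>.\<close>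
  have le_powr: "c' \<le> x powr (p * \<alpha> / 2 - 1)" if x: "1 \<le> x" "real n\<^sub>0 powr (1 / p) \<le> x" for x
  proof -
    define N where "N = (C + 1) * x powr p"
    define n where "n = nat \<lceil>N\<rceil>"
    have xp: "1 \<le> x powr p" using x(1) p by (simp add: ge_one_powr_ge_zero)
    then have "1 * 1 \<le> N" unfolding N_def using C by (intro mult_mono) auto
    then have N: "1 \<le> N" by simp
    have "N \<le> real n" by (simp add: n_def real_nat_ceiling_ge)
    have n_le: "real n \<le> 2 * N" unfolding n_def using N by linarith
    have "(real n\<^sub>0 powr (1 / p)) powr p \<le> x powr p" using x(2) p by (intro powr_mono2) auto
    then have "real n\<^sub>0 \<le> x powr p" using p by (simp add: powr_powr)
    also have "\<dots> \<le> N" unfolding N_def using C by (simp add: distrib_right)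
    finally have "n\<^sub>0 \<le> n" using \<open>N \<le> real n\<close> by linarith
    have inv: "inverse x powr (- p) = x powr p" using x(1) by (simp add: powr_minus inverse_powr)
    have "C * x powr p < N" using x(1) by (simp add: N_def distrib_right)
    moreover have "comp_nest W D k a \<rho> \<gamma> dollar (inverse x) \<le> ennreal (C * x powr p)"
      using comp[of "inverse x"] x(1) inv by (simp add: inverse_le_1_iff)
    ultimately have "comp_nest W D k a \<rho> \<gamma> dollar (inverse x) < ennreal N"
      using N C by (auto intro: le_less_trans simp: ennreal_less_iff)
    then have "min_err_uni W D k \<rho> \<gamma> dollar n \<le> ennreal (inverse x)"
      using x(1) \<open>N \<le> real n\<close> by (intro min_err_uni_le[OF mono ge1]) auto
    with n\<^sub>0[OF \<open>n\<^sub>0 \<le> n\<close>] have "ennreal (c * real n powr (- \<alpha> / 2)) \<le> ennreal (inverse x)"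
      by (rule order_trans)
    then have le: "c * real n powr (- \<alpha> / 2) \<le> inverse x" using x(1) by (simp add: ennreal_le_iff)
    have "2 * N = (2 * (C + 1)) * x powr p" by (simp add: N_def)
    then have "c' * x powr (- (p * \<alpha> / 2)) = c * (2 * N) powr (- \<alpha> / 2)"
      unfolding c'_def using C by (simp only: powr_mult powr_powr) (simp add: powr_powr)
    also have "\<dots> \<le> c * real n powr (- \<alpha> / 2)"
      using c \<alpha> n_le N \<open>N \<le> real n\<close> by (intro mult_left_mono powr_mono2') auto
    also note le
    finally have "c' * x powr (- (p * \<alpha> / 2)) * x powr (p * \<alpha> / 2) \<le> inverse x * x powr (p * \<alpha> / 2)"
      by (rule mult_right_mono) simp
    moreover have "x powr (- (p * \<alpha> / 2)) * x powr (p * \<alpha> / 2) = 1"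
      using x(1) by (simp flip: powr_add)
    ultimately have "c' \<le> inverse x * x powr (p * \<alpha> / 2)" by (simp only: mult.assoc mult_1_right)
    also have "\<dots> = x powr (-1) * x powr (p * \<alpha> / 2)" using x(1) by (simp add: powr_minus)
    also have "\<dots> = x powr (-1 + p * \<alpha> / 2)" by (rule powr_add[symmetric])
    also have "-1 + p * \<alpha> / 2 = p * \<alpha> / 2 - 1" by simp
    finally show ?thesis .
  qed
  have "((\<lambda>x. x powr (p * \<alpha> / 2 - 1)) \<longlongrightarrow> 0) at_top"
    using neg by (intro tendsto_neg_powr filterlim_ident) auto
  moreover have "\<forall>\<^sub>F x in at_top. c' \<le> x powr (p * \<alpha> / 2 - 1)"
    using eventually_ge_at_top[of 1] eventually_ge_at_top[of "real n\<^sub>0 powr (1 / p)"]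
    by eventually_elim (rule le_powr)
  ultimately have "c' \<le> 0" by (rule tendsto_lowerbound) simp
  then show False using c C by (simp add: c'_def mult_le_0_iff)
qed

end

section \<open>From single exponents to the exponent of tractability\<close>

theorem theorem3p3:
  fixes D :: "real set" and k :: "real \<Rightarrow> real \<Rightarrow> real" and a :: real
    and \<rho> :: "real measure" and \<gamma> :: "nat set \<Rightarrow> real"
    and dollar :: "nat \<Rightarrow> ennreal" and s \<alpha> :: real and W :: "'w itself"
  assumes D_borel: "D \<in> sets borel"
    and k_kernel: "pd_kernel D k"
    and k_nonzero: "\<exists>x\<in>D. \<exists>y\<in>D. k x y \<noteq> 0"
    and k_meas: "case_prod k \<in> borel_measurable (restrict_space borel D \<Otimes>\<^sub>M restrict_space borel D)"
    and anchor: "a \<in> D" "k a a = 0"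
    and rho_prob: "prob_space \<rho>"
    and rho_sets: "sets \<rho> = sets (restrict_space borel D)"
    and M_finite: "integrable \<rho> (\<lambda>x. k x x)"
    and gamma_nonneg: "\<forall>u. finite u \<longrightarrow> \<gamma> u \<ge> 0"
    and gamma_summable: "(\<lambda>u. \<gamma> u * (\<integral>x. k x x \<partial>\<rho>) ^ card u) summable_on {u. finite u}"
    and C0_pos: "C0 \<rho> k > 0"
    and dollar_mono: "mono dollar"
    and dollar_ge1: "\<forall>n. dollar n \<ge> 1"
    and s_pos: "s > 0"
    and dollar_growth: "\<exists>c>0. \<forall>\<^sub>F \<nu> in sequentially. dollar \<nu> \<ge> ennreal (c * real \<nu> powr s)"
    and gamma_1: "\<gamma> {0} > 0"
    and alpha_pos: "\<alpha> > 0"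
    and univariate_lb: "\<exists>c>0. \<forall>\<^sub>F N in sequentially.
          min_err_uni W D k \<rho> \<gamma> dollar N \<ge> ennreal (c * real N powr (- \<alpha> / 2))"
  shows "(strong_poly_tractable W D k a \<rho> \<gamma> dollar \<longrightarrow> (\<forall>\<sigma>\<ge>1. decay \<rho> k \<gamma> \<sigma> > 1))
       \<and> ((\<forall>\<sigma>\<ge>1. decay \<rho> k \<gamma> \<sigma> > 1) \<longrightarrow>
          p_ran_nest W D k a \<rho> \<gamma> dollar \<ge> max (ereal (2 / \<alpha>)) (SUP \<sigma>\<in>{1..}. lb_term \<rho> k \<gamma> s \<sigma>))"
proof -
  interpret kernel_prob_space \<rho> D k
    using rho_prob k_kernel k_meas rho_sets M_finite
    by (simp add: kernel_prob_space_def kernel_prob_space_axioms_def)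
  interpret anchored_kernel \<rho> D k a \<gamma>
    using anchor gamma_nonneg gamma_summable C0_pos by unfold_locales auto
  have ge1: "1 \<le> dollar 1" using dollar_ge1 by blast
  define admissible where "admissible p \<longleftrightarrow> 0 \<le> p \<and>
    (\<exists>C\<ge>0. \<forall>\<epsilon>>0. comp_nest W D k a \<rho> \<gamma> dollar \<epsilon> \<le> ennreal (C * \<epsilon> powr (-p)))" for p
  \<comment> \<open>An admissible exponent may be \<open>0\<close>, while the estimates above ask
    for a positive one. A larger exponent preserves the bound for \<open>\<epsilon> \<le> 1\<close>,
    which is the range those estimates use.\<close>
  have larger: "\<exists>C\<ge>0. \<forall>\<epsilon>>0. \<epsilon> \<le> 1 \<longrightarrow> comp_nest W D k a \<rho> \<gamma> dollar \<epsilon> \<le> ennreal (C * \<epsilon> powr (-p'))"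
    if "admissible p" "p < p'" for p p'
  proof -
    from that obtain C where C: "0 \<le> C"
      "\<And>\<epsilon>. 0 < \<epsilon> \<Longrightarrow> comp_nest W D k a \<rho> \<gamma> dollar \<epsilon> \<le> ennreal (C * \<epsilon> powr (-p))"
      by (auto simp: admissible_def)
    have "comp_nest W D k a \<rho> \<gamma> dollar \<epsilon> \<le> ennreal (C * \<epsilon> powr (-p'))" if "0 < \<epsilon>" "\<epsilon> \<le> 1" for \<epsilon>
    proof -
      have "\<epsilon> powr (-p) \<le> \<epsilon> powr (-p')" using that \<open>p < p'\<close> by (intro powr_mono') auto
      then show ?thesis using C(1) by (intro order_trans[OF C(2)[OF that(1)]] ennreal_leI mult_left_mono)
    qed
    then show ?thesis using C(1) by blast
  qed
  have bound: "ereal (2 / \<alpha>) \<le> ereal p \<and> lb_term \<rho> k \<gamma> s \<sigma> \<le> ereal p" if p: "admissible p" for p \<sigma>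
  proof -
    \<comment> \<open>The estimates are applied to every exponent above \<open>p\<close>; density
      then gives them for \<open>p\<close> itself.\<close>
    have *: "ereal (2 / \<alpha>) \<le> z \<and> lb_term \<rho> k \<gamma> s \<sigma> \<le> z" if z: "ereal p < z" for z
    proof (cases z)
      case (real p')
      then have p': "p < p'" "0 < p'" using z p by (auto simp: admissible_def)
      obtain C where C: "0 \<le> C" "\<And>\<epsilon>. 0 < \<epsilon> \<Longrightarrow> \<epsilon> \<le> 1 \<Longrightarrow>
          comp_nest W D k a \<rho> \<gamma> dollar \<epsilon> \<le> ennreal (C * \<epsilon> powr (-p'))"
        using larger[OF p p'(1)] by blast
      show ?thesis
        using univariate_exponent_le[OF dollar_mono ge1 alpha_pos univariate_lb p'(2) C]
          lb_term_le[OF s_pos dollar_growth p'(2) C] real by simp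
    qed (use z in auto)
    show ?thesis using dense_ge[of "ereal p"] * by blast
  qed
  show ?thesis
  proof (intro conjI impI allI)
    fix \<sigma> assume "strong_poly_tractable W D k a \<rho> \<gamma> dollar"
    then obtain p where p: "admissible p"
      unfolding strong_poly_tractable_def admissible_def by blast
    then have "0 < p + 1" by (simp add: admissible_def)
    moreover obtain C where "0 \<le> C" "\<And>\<epsilon>. 0 < \<epsilon> \<Longrightarrow> \<epsilon> \<le> 1 \<Longrightarrow>
        comp_nest W D k a \<rho> \<gamma> dollar \<epsilon> \<le> ennreal (C * \<epsilon> powr (-(p + 1)))"
      using larger[OF p, of "p + 1"] by auto
    ultimately show "1 < decay \<rho> k \<gamma> \<sigma>" by (rule decay_gt_1[OF s_pos dollar_growth])
  next
    show "max (ereal (2 / \<alpha>)) (SUP \<sigma>\<in>{1..}. lb_term \<rho> k \<gamma> s \<sigma>) \<le> p_ran_nest W D k a \<rho> \<gamma> dollar"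
      unfolding p_ran_nest_def
    proof (rule Inf_greatest)
      fix z assume "z \<in> {ereal p |p. 0 \<le> p \<and>
        (\<exists>C\<ge>0. \<forall>\<epsilon>>0. comp_nest W D k a \<rho> \<gamma> dollar \<epsilon> \<le> ennreal (C * \<epsilon> powr - p))}"
      then obtain p where "z = ereal p" "admissible p" unfolding admissible_def by blast
      then show "max (ereal (2 / \<alpha>)) (SUP \<sigma>\<in>{1..}. lb_term \<rho> k \<gamma> s \<sigma>) \<le> z"
        using bound by (auto intro: SUP_least)
    qed
  qed
qed

end
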